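(* Let $\alpha\in(0,2]$, $\beta\in(0,1)$, $\nu>0$, $d\ge1$. Suppose there exist a non-negative function $J$ on $\mathbb{R}^d$ and finite positive constants $Lip_\sigma$, $K$ with $\sigma(0,h)=0$, $|\sigma(x,h)-\sigma(y,h)|\le J(h)Lip_\sigma|x-y|$ for all $x,y\in\mathbb{R}$, $h\in\mathbb{R}^d$, and $\int_{\mathbb{R}^d}J(h)\,\mu(dh)\le K$. Let $\gamma>0$ and let $u$ be a predictable random field solution of $$\frac{\partial^\beta u}{\partial t^\beta}+\nu(-\Delta)^{\alpha/2}u=I_t^{1-\beta}\Big[\int_{\mathbb{R}^d}\sigma(u(t,x),h)\,\dot{N}(t,x,h)\Big]$$ with $\|u\|_{1,\gamma}<\infty$. Then $$\|\mathcal{B}u\|_{1,\gamma}\le\frac{K\,Lip_\sigma}{\gamma}\|u\|_{1,\gamma},$$ where $\mathcal{B}u(t,x):=\int_0^t\int_{\mathbb{R}^d}\int_{\mathbb{R}^d}G(t-s,y-x)\sigma(u(s,y),h)\,N(ds\,dy\,dh)$.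
   Context: Noise: $\mu$ is a Lévy measure on $\mathbb{R}^d$, i.e. $\int_{\mathbb{R}^d}(1\wedge|h|^2)\mu(dh)<\infty$. $N$ is a (non-compensated) Poisson random measure on $\mathbb{R}_+\times\mathbb{R}^d\times\mathbb{R}^d$ with intensity $dt\,dx\,\mu(dh)$. Predictability is with respect to the filtration generated by $N$. For predictable $X$ with $\int_0^T\int\int \mathbb{E}|X(s,x,h)|\,ds\,dx\,\mu(dh)<\infty$, the integral $\int_0^T\int\int X\,dN$ is defined and satisfies $\mathbb{E}\int X\,dN=\int_0^T\int\int\mathbb{E}X\,ds\,dx\,\mu(dh)$. The function $\sigma:\mathbb{R}\times\mathbb{R}^d\to\mathbb{R}$ is jointly measurable. Kernel: $G_t(x)=G(t,x)=\int_0^\infty p_{X(s)}(x)f_{E_t}(s)\,ds$, where $p_{X(s)}$ is the density with Fourier transform $\widehat{p_{X(s)}}(\xi)=e^{-s\nu|\xi|^\alpha}$ (isotropic $\alpha$-stable process on $\mathbb{R}^d$) and $f_{E_t}(s)=t\beta^{-1}s^{-1-1/\beta}g_\beta(ts^{-1/\beta})$ is the density of the inverse $\beta$-stable subordinator $E_t$, $g_\beta$ being the density of $D_1$ for the $\beta$-stable subordinator $D$ with $\mathbb{E}e^{-\lambda D_1}=e^{-\lambda^\beta}$. Norm: $\|u\|_{1,\gamma}:=\sup_{t>0}\sup_{x\in\mathbb{R}^d}e^{-\gamma t}\mathbb{E}|u(t,x)|$. A random field solution of the equation (for some measurable bounded initial function $u_0$) is a random field satisfying, for all $t,x$, a.s.,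 $u(t,x)=\int_{\mathbb{R}^d}G(t,x-y)u_0(y)\,dy+\mathcal{B}u(t,x)$, and $\sup_{0\le t\le T}\sup_{x}\mathbb{E}|u(t,x)|<\infty$ for all $T>0$. *)

theory Defs
  imports "HOL-Probability.Probability"
begin

text \<open>
  Sigma-finiteness only excludes infinite mass at the origin, which the integral condition does
  not see; the usual convention of no mass at the origin is a special case.
\<close>

definition levy_measure :: "(real ^ 'd) measure \<Rightarrow> bool" where
  "levy_measure \<mu> \<longleftrightarrow>
     sets \<mu> = sets borel \<and> sigma_finite_measure \<mu> \<and>
     (\<integral>\<^sup>+ h. ennreal (min 1 ((norm h)\<^sup>2)) \<partial>\<mu>) < \<infinity>"

definition intensity :: "(real ^ 'd) measure \<Rightarrow> (real \<times> (real ^ 'd) \<times> (real ^ 'd)) measure" where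
  "intensity \<mu> = restrict_space lborel {0..} \<Otimes>\<^sub>M (lborel \<Otimes>\<^sub>M \<mu>)"

text \<open>
  The Poisson weights are written out because the library's \<open>poisson_pmf\<close> is specified for
  positive rates only, whereas sets of intensity zero are needed here.
\<close>

definition poisson_random_measure ::
    "'w measure \<Rightarrow> 'a measure \<Rightarrow> ('w \<Rightarrow> 'a measure) \<Rightarrow> bool" where
  "poisson_random_measure P \<Lambda> N \<longleftrightarrow>
     prob_space P \<and>
     (\<forall>\<omega>\<in>space P. sets (N \<omega>) = sets \<Lambda>) \<and>
     (\<forall>\<omega>\<in>space P. \<forall>A\<in>sets \<Lambda>. \<exists>k. emeasure (N \<omega>) A = ennreal_of_enat k) \<and>
     (\<forall>A\<in>sets \<Lambda>. (\<lambda>\<omega>. emeasure (N \<omega>) A) \<in> borel_measurable P) \<and>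
     (\<forall>A\<in>sets \<Lambda>. emeasure \<Lambda> A < \<infinity> \<longrightarrow>
        (\<forall>k::nat. measure P {\<omega>\<in>space P. emeasure (N \<omega>) A = of_nat k} =
           measure \<Lambda> A ^ k / fact k * exp (- measure \<Lambda> A))) \<and>
     (\<forall>A\<in>sets \<Lambda>. emeasure \<Lambda> A = \<infinity> \<longrightarrow> (AE \<omega> in P. emeasure (N \<omega>) A = \<infinity>)) \<and>
     (\<forall>(n::nat) A. (\<forall>i<n. A i \<in> sets \<Lambda>) \<and> disjoint_family_on A {..<n} \<longrightarrow>
        prob_space.indep_vars P (\<lambda>_. borel) (\<lambda>i \<omega>. emeasure (N \<omega>) (A i)) {..<n})"

definition noise_filtration ::
    "'w measure \<Rightarrow> (real ^ 'd) measure \<Rightarrow> ('w \<Rightarrow> (real \<times> (real ^ 'd) \<times> (real ^ 'd)) measure)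
      \<Rightarrow> real \<Rightarrow> 'w measure" where
  "noise_filtration P \<mu> N t =
     sigma (space P)
       {(\<lambda>\<omega>. emeasure (N \<omega>) A) -` B \<inter> space P | A B.
          A \<in> sets (intensity \<mu>) \<and> A \<subseteq> {0..t} \<times> UNIV \<and> B \<in> sets borel}"

definition predictable_sigma :: "'w set \<Rightarrow> (real \<Rightarrow> 'w measure) \<Rightarrow> ('w \<times> real) measure" where
  "predictable_sigma \<Omega> F =
     sigma (\<Omega> \<times> {0..})
       ({A \<times> {a<..b} | A a b. 0 \<le> a \<and> a < b \<and> A \<in> sets (F a)} \<union>
        {A \<times> {0} | A. A \<in> sets (F 0)})"

definition predictable_field ::
    "'w measure \<Rightarrow> (real ^ 'd) measure \<Rightarrow> ('w \<Rightarrow> (real \<times> (real ^ 'd) \<times> (real ^ 'd)) measure)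
      \<Rightarrow> (real \<Rightarrow> real ^ 'd \<Rightarrow> 'w \<Rightarrow> real) \<Rightarrow> bool" where
  "predictable_field P \<mu> N u \<longleftrightarrow>
     (\<lambda>((\<omega>, t), x). u t x \<omega>) \<in>
       borel_measurable (predictable_sigma (space P) (noise_filtration P \<mu> N) \<Otimes>\<^sub>M borel)"

text \<open>
  A density is determined only up to null sets; joint continuity selects the usual transition
  density of the isotropic stable process.  The total mass is one by the case \<open>\<xi> = 0\<close>.
\<close>

definition isotropic_stable_density ::
    "real \<Rightarrow> real \<Rightarrow> (real \<Rightarrow> real ^ 'd \<Rightarrow> real) \<Rightarrow> bool" where
  "isotropic_stable_density \<nu> \<alpha> p \<longleftrightarrow>
     continuous_on ({0<..} \<times> UNIV) (\<lambda>(s, x). p s x) \<and>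
     (\<forall>s>0. (\<forall>x. 0 \<le> p s x) \<and> integrable lborel (p s) \<and>
        (\<forall>\<xi>. (\<integral>x. cis (\<xi> \<bullet> x) * complex_of_real (p s x) \<partial>lborel) =
              complex_of_real (exp (- s * \<nu> * norm \<xi> powr \<alpha>))))"

text \<open>
  The density of \<open>D\<^sub>1\<close> for the stable subordinator; no version need be selected, since
  the kernel below depends only on its class up to null sets.
\<close>

definition stable_subordinator_density :: "real \<Rightarrow> (real \<Rightarrow> real) \<Rightarrow> bool" where
  "stable_subordinator_density \<beta> g \<longleftrightarrow>
     (\<forall>x. 0 \<le> g x) \<and> (\<forall>x<0. g x = 0) \<and> integrable lborel g \<and>
     (\<forall>l\<ge>0. (\<integral>x. exp (- l * x) * g x \<partial>lborel) = exp (- (l powr \<beta>)))"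

definition inverse_subordinator_density :: "real \<Rightarrow> (real \<Rightarrow> real) \<Rightarrow> real \<Rightarrow> real \<Rightarrow> real" where
  "inverse_subordinator_density \<beta> g t s =
     t / \<beta> * s powr (- 1 - 1 / \<beta>) * g (t * s powr (- 1 / \<beta>))"

text \<open>
  Where the integral diverges (for \<open>t > 0\<close> this can happen only at \<open>x = 0\<close>, when \<open>d \<ge> \<alpha>\<close>) the
  value is 0 by convention.  This is a null set in \<open>x\<close>, hence irrelevant both for Lebesgue
  integrals and, almost surely, for integrals against the noise.
\<close>

definition green_kernel ::
    "real \<Rightarrow> (real \<Rightarrow> real) \<Rightarrow> (real \<Rightarrow> real ^ 'd \<Rightarrow> real) \<Rightarrow> real \<Rightarrow> real ^ 'd \<Rightarrow> real" where
  "green_kernel \<beta> g p t x = (LBINT s:{0<..}. p s x * inverse_subordinator_density \<beta> g t s)"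

text \<open>
  The noise is not compensated, so the stochastic integral is the pathwise Lebesgue integral
  against the measure \<open>N \<omega>\<close>; for predictable integrands that are integrable with respect to
  \<open>P\<close> times the intensity, it is almost surely absolutely convergent.
\<close>

definition stochastic_convolution ::
    "('w \<Rightarrow> (real \<times> (real ^ 'd) \<times> (real ^ 'd)) measure) \<Rightarrow> (real \<Rightarrow> real ^ 'd \<Rightarrow> real)
      \<Rightarrow> (real \<Rightarrow> real ^ 'd \<Rightarrow> real) \<Rightarrow> (real \<Rightarrow> real ^ 'd \<Rightarrow> 'w \<Rightarrow> real)
      \<Rightarrow> real \<Rightarrow> real ^ 'd \<Rightarrow> 'w \<Rightarrow> real" where
  "stochastic_convolution N G \<sigma> u t x \<omega> =
     (LINT (s, y, h) : {0<..t} \<times> UNIV | N \<omega>. G (t - s) (y - x) * \<sigma> (u s y \<omega>) h)"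

text \<open>At time 0 the kernel is the Dirac mass, so the deterministic part is the initial function.\<close>

definition initial_evolution ::
    "(real \<Rightarrow> real ^ 'd \<Rightarrow> real) \<Rightarrow> (real ^ 'd \<Rightarrow> real) \<Rightarrow> real \<Rightarrow> real ^ 'd \<Rightarrow> real" where
  "initial_evolution G u0 t x =
     (if t = 0 then u0 x else (\<integral>y. G t (x - y) * u0 y \<partial>lborel))"

definition random_field_solution ::
    "'w measure \<Rightarrow> ('w \<Rightarrow> (real \<times> (real ^ 'd) \<times> (real ^ 'd)) measure)
      \<Rightarrow> (real \<Rightarrow> real ^ 'd \<Rightarrow> real) \<Rightarrow> (real \<Rightarrow> real ^ 'd \<Rightarrow> real) \<Rightarrow> (real ^ 'd \<Rightarrow> real)
      \<Rightarrow> (real \<Rightarrow> real ^ 'd \<Rightarrow> 'w \<Rightarrow> real) \<Rightarrow> bool" where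
  "random_field_solution P N G \<sigma> u0 u \<longleftrightarrow>
     (\<forall>t\<ge>0. \<forall>x. u t x \<in> borel_measurable P) \<and>
     (\<forall>t\<ge>0. \<forall>x. AE \<omega> in P.
        u t x \<omega> = initial_evolution G u0 t x + stochastic_convolution N G \<sigma> u t x \<omega>) \<and>
     (\<forall>T>0. (SUP t\<in>{0..T}. SUP x. \<integral>\<^sup>+ \<omega>. ennreal \<bar>u t x \<omega>\<bar> \<partial>P) < \<infinity>)"

definition norm_1 :: "'w measure \<Rightarrow> real \<Rightarrow> (real \<Rightarrow> real ^ 'd \<Rightarrow> 'w \<Rightarrow> real) \<Rightarrow> ennreal" where
  "norm_1 P \<gamma> u =
     (SUP t\<in>{0<..}. SUP x. ennreal (exp (- \<gamma> * t)) * (\<integral>\<^sup>+ \<omega>. ennreal \<bar>u t x \<omega>\<bar> \<partial>P))"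

end

theory Submission
  imports Defs
begin

text \<open>
  The noise is a kernel with nonnegative values, so the modulus of the stochastic integral is
  pathwise at most the integral of the modulus.  Campbell's formula for predictable integrands turns
  the expectation of the latter into an integral against the intensity: on a predictable rectangle
  \<open>A \<times> ]a, b] \<times> W\<close> it is the independence of the past \<open>A\<close> from the number of points
  in \<open>]a, b] \<times> W\<close>, and the general case follows by a monotone class argument.  The
  Lipschitz condition bounds \<open>\<sigma>\<close> by \<open>J\<close> times \<open>|u|\<close>, the kernel \<open>G t\<close>
  has mass at most one, and what remains is \<open>\<integral>\<^sub>0\<^sup>t e\<^bsup>\<gamma>s\<^esup> ds \<le> e\<^bsup>\<gamma>t\<^esup> / \<gamma>\<close>.
\<close>

section \<open>Means and independence for Poisson random measures\<close>

text \<open>The integrand varies with the same \<omega> as the noise, so comparing mean measures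
  alone is not enough. The noise and the intensity are therefore treated as two kernels in \<omega>,
  the second one constant, and the integrand as a single function on the predictable product space,
  pulled back along the section map \<open>h \<omega>\<close>. Equality of expectations then has to
  be checked on a generator only. The obstacle is closure under complements: it subtracts, hence
  needs finite counts, while the intensity is merely sigma-finite. So the space is cut into disjoint
  pieces \<open>E n\<close> of finite intensity, and the pieces are summed afterwards. Rectangles
  over time 0 stand apart: an event of \<open>F 0\<close> may depend on the points at time 0, so
  independence says nothing, but that slice has intensity zero. Everything takes place in
  \<open>ennreal\<close>, where Campbell's formula and Tonelli's theorem apply before any finiteness
  is known. In the constant, \<open>Lip\<close> stems from the Lipschitz bound, \<open>K\<close>
  from the integral of \<open>J\<close> and 1/\<gamma> from the exponential integral; the remaining
  \<open>exp (\<gamma> * t)\<close> is cancelled by the weight of the norm.\<close>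

lemma
  assumes "poisson_random_measure P \<Lambda> N"
  shows prm_prob_space: "prob_space P"
    and prm_sets: "\<omega> \<in> space P \<Longrightarrow> sets (N \<omega>) = sets \<Lambda>"
    and prm_measurable: "A \<in> sets \<Lambda> \<Longrightarrow> (\<lambda>\<omega>. emeasure (N \<omega>) A) \<in> borel_measurable P"
    and prm_poisson: "A \<in> sets \<Lambda> \<Longrightarrow> emeasure \<Lambda> A < \<infinity> \<Longrightarrow>
      measure P {\<omega>\<in>space P. emeasure (N \<omega>) A = of_nat k} =
        measure \<Lambda> A ^ k / fact k * exp (- measure \<Lambda> A)"
    and prm_indep_vars_lessThan: "(\<forall>i<n. C i \<in> sets \<Lambda>) \<and> disjoint_family_on C {..<n} \<Longrightarrow>
      prob_space.indep_vars P (\<lambda>_. borel) (\<lambda>i \<omega>. emeasure (N \<omega>) (C i)) {..<n::nat}"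
  using assms unfolding poisson_random_measure_def by blast+

text \<open>The factor \<open>k\<close> cancels against the factorial, leaving
  \<open>l * exp (- l)\<close> times the exponential series with its index shifted by one; the term
  at \<open>k = 0\<close> vanishes.\<close>

lemma poisson_mean_sums:
  fixes l :: real
  shows "(\<lambda>k. real k * (l ^ k / fact k * exp (- l))) sums l"
proof -
  have "(\<lambda>k. l ^ k /\<^sub>R fact k) sums exp l"
    by (rule exp_converges)
  then have "(\<lambda>k. (l * exp (- l)) * (l ^ k /\<^sub>R fact k)) sums ((l * exp (- l)) * exp l)"
    by (rule sums_mult)
  moreover have "(l * exp (- l)) * (l ^ k /\<^sub>R fact k) =
      real (Suc k) * (l ^ Suc k / fact (Suc k) * exp (- l))" for k
    by (simp add: field_simps del: of_nat_Suc)
  moreover have "(l * exp (- l)) * exp l = l"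
    by (simp add: exp_minus)
  ultimately have "(\<lambda>k. real (Suc k) * (l ^ Suc k / fact (Suc k) * exp (- l))) sums l"
    by simp
  from sums_Suc[OF this] show ?thesis by simp
qed

lemma poisson_total_sums:
  fixes l :: real
  shows "(\<lambda>k. l ^ k / fact k * exp (- l)) sums 1"
  using sums_mult[OF exp_converges[of l], of "exp (- l)"]
  by (simp add: exp_minus field_simps)

text \<open>Pathwise a count may be infinite. The Poisson weights of the finite values already sum
  to one, which leaves no probability for the value \<infinity>.\<close>

lemma prm_finite:
  assumes prm: "poisson_random_measure P \<Lambda> N"
    and A: "A \<in> sets \<Lambda>" "emeasure \<Lambda> A < \<infinity>"
  shows "AE \<omega> in P. \<exists>k::nat. emeasure (N \<omega>) A = of_nat k"
proof -
  interpret prob_space P using prm by (rule prm_prob_space)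
  note [measurable] = prm_measurable[OF prm A(1)]
  let ?E = "\<lambda>k::nat. {\<omega>\<in>space P. emeasure (N \<omega>) A = of_nat k}"
  have "disjoint_family ?E"
    by (auto simp: disjoint_family_on_def)
  then have "(\<lambda>k. prob (?E k)) sums prob (\<Union>k. ?E k)"
    by (intro finite_measure_UNION) auto
  moreover have "(\<lambda>k. prob (?E k)) sums 1"
    unfolding prm_poisson[OF prm A] by (rule poisson_total_sums)
  ultimately have "prob (\<Union>k. ?E k) = 1"
    by (rule sums_unique2)
  then have "AE \<omega> in P. \<omega> \<in> (\<Union>k. ?E k)"
    by (rule AE_in_set_eq_1[THEN iffD2, rotated]) auto
  then show ?thesis by eventually_elim auto
qed

lemma prm_mean:
  assumes prm: "poisson_random_measure P \<Lambda> N"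
    and A: "A \<in> sets \<Lambda>" "emeasure \<Lambda> A < \<infinity>"
  shows "(\<integral>\<^sup>+\<omega>. emeasure (N \<omega>) A \<partial>P) = emeasure \<Lambda> A"
proof -
  interpret prob_space P using prm by (rule prm_prob_space)
  note [measurable] = prm_measurable[OF prm A(1)]
  let ?E = "\<lambda>k::nat. {\<omega>\<in>space P. emeasure (N \<omega>) A = of_nat k}"
  let ?l = "measure \<Lambda> A"
  have E [measurable]: "?E k \<in> sets P" for k by auto
  \<comment> \<open>Writing the count as a series over its possible values allows integration term
    by term. At an infinite count all indicators vanish, hence only an almost sure identity.\<close>
  have "AE \<omega> in P. emeasure (N \<omega>) A = (\<Sum>k. of_nat k * indicator (?E k) \<omega>)"
    using prm_finite[OF prm A] AE_space
  proof eventually_elim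
    case (elim \<omega>)
    then obtain k :: nat where k: "emeasure (N \<omega>) A = of_nat k" by auto
    have "(\<Sum>j. of_nat j * indicator (?E j) \<omega> :: ennreal) = (\<Sum>j\<in>{k}. of_nat j * indicator (?E j) \<omega>)"
      using k by (intro suminf_finite) auto
    then show ?case using k elim by simp
  qed
  then have "(\<integral>\<^sup>+\<omega>. emeasure (N \<omega>) A \<partial>P) = (\<integral>\<^sup>+\<omega>. (\<Sum>k. of_nat k * indicator (?E k) \<omega>) \<partial>P)"
    by (rule nn_integral_cong_AE)
  also have "\<dots> = (\<Sum>k. \<integral>\<^sup>+\<omega>. of_nat k * indicator (?E k) \<omega> \<partial>P)"
    by (intro nn_integral_suminf) auto
  also have "\<dots> = (\<Sum>k. ennreal (real k * (?l ^ k / fact k * exp (- ?l))))"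
  proof (intro suminf_cong)
    fix k
    have "(\<integral>\<^sup>+\<omega>. of_nat k * indicator (?E k) \<omega> \<partial>P) = of_nat k * emeasure P (?E k)"
      by (rule nn_integral_cmult_indicator) auto
    also have "\<dots> = ennreal (real k * prob (?E k))"
      by (simp add: emeasure_eq_measure ennreal_mult' ennreal_of_nat_eq_real_of_nat)
    finally show "(\<integral>\<^sup>+\<omega>. of_nat k * indicator (?E k) \<omega> \<partial>P) =
        ennreal (real k * (?l ^ k / fact k * exp (- ?l)))"
      unfolding prm_poisson[OF prm A] .
  qed
  also have "\<dots> = ennreal ?l"
    by (intro suminf_ennreal_eq poisson_mean_sums) auto
  also have "\<dots> = emeasure \<Lambda> A"
    using A(2) by (simp add: emeasure_eq_ennreal_measure)
  finally show ?thesis .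
qed

text \<open>Independence is assumed for families over initial segments of the naturals; an
  enumeration of \<open>I\<close> carries it over. Below, the index set consists of subsets of a
  finite set system.\<close>

lemma prm_indep_vars:
  assumes prm: "poisson_random_measure P \<Lambda> N"
    and I: "finite I" and A: "\<And>i. i \<in> I \<Longrightarrow> A i \<in> sets \<Lambda>" "disjoint_family_on A I"
  shows "prob_space.indep_vars P (\<lambda>_. borel) (\<lambda>i \<omega>. emeasure (N \<omega>) (A i)) I"
proof -
  interpret prob_space P using prm by (rule prm_prob_space)
  obtain f where f: "bij_betw f {..<card I} I"
    using ex_bij_betw_nat_finite[OF I] by (auto simp: atLeast0LessThan)
  have "disjoint_family_on (\<lambda>i. A (f i)) {..<card I}"
    using f A(2) unfolding disjoint_family_on_def bij_betw_def inj_on_def by blast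
  moreover have "\<forall>i<card I. A (f i) \<in> sets \<Lambda>"
    using A(1) f by (auto simp: bij_betw_def)
  ultimately have "indep_vars (\<lambda>_. borel) (\<lambda>i \<omega>. emeasure (N \<omega>) (A (f i))) {..<card I}"
    by (intro prm_indep_vars_lessThan[OF prm]) simp
  then have *: "indep_vars ((\<lambda>_. borel) \<circ> f) ((\<lambda>i \<omega>. emeasure (N \<omega>) (A i)) \<circ> f) {..<card I}"
    by (simp add: comp_def)
  have img: "I = f ` {..<card I}" and inj: "inj_on f {..<card I}"
    using f by (auto simp: bij_betw_def)
  show ?thesis
    unfolding indep_vars_def2
  proof (intro conjI ballI)
    fix i assume "i \<in> I"
    then show "random_variable borel (\<lambda>\<omega>. emeasure (N \<omega>) (A i))"
      using prm_measurable[OF prm A(1)] by simp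
  next
    let ?F = "\<lambda>i. {(\<lambda>\<omega>. emeasure (N \<omega>) (A i)) -` B \<inter> space P |B. B \<in> sets borel}"
    have F: "indep_sets (\<lambda>j. ?F (f j)) {..<card I}"
      using * unfolding indep_vars_def2 by (simp add: comp_def)
    show "indep_sets ?F I"
    proof (rule indep_setsI)
      fix i assume "i \<in> I"
      then obtain j where "j < card I" "i = f j" using img by auto
      then show "?F i \<subseteq> events"
        using F unfolding indep_sets_def by auto
    next
      fix B J assume J: "J \<noteq> {}" "J \<subseteq> I" "finite J" "\<forall>j\<in>J. B j \<in> ?F j"
      obtain L where L: "L \<subseteq> {..<card I}" "J = f ` L"
        using J(2) img by (metis subset_image_iff)
      have injL: "inj_on f L" using inj L(1) by (rule inj_on_subset)
      have "prob (\<Inter>j\<in>L. B (f j)) = (\<Prod>j\<in>L. prob (B (f j)))"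
      proof (rule indep_setsD[OF F L(1)])
        show "finite L" using J(3) L(2) injL by (simp add: finite_image_iff)
      qed (use J L in auto)
      then show "prob (\<Inter>j\<in>J. B j) = (\<Prod>j\<in>J. prob (B j))"
        unfolding L(2) by (simp add: prod.reindex[OF injL])
    qed
  qed
qed

text \<open>\<open>indep_var\<close> is \<open>indep_vars\<close> over the two Booleans, so the
  product formula for finite families applies once \<open>case_bool borel borel\<close> is seen to
  be a constant family.\<close>

lemma (in prob_space) indep_var_nn_integral:
  fixes X Y :: "'a \<Rightarrow> ennreal"
  assumes "indep_var borel X borel Y"
  shows "(\<integral>\<^sup>+\<omega>. X \<omega> * Y \<omega> \<partial>M) = (\<integral>\<^sup>+\<omega>. X \<omega> \<partial>M) * (\<integral>\<^sup>+\<omega>. Y \<omega> \<partial>M)"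
proof -
  have "case_bool borel borel = (\<lambda>_::bool. borel :: ennreal measure)"
    by (auto simp: fun_eq_iff split: bool.split)
  then have "indep_vars (\<lambda>_. borel) (case_bool X Y) UNIV"
    using assms unfolding indep_var_def by simp
  from indep_vars_nn_integral[OF _ this] show ?thesis
    by (simp add: UNIV_bool mult.commute)
qed

text \<open>
  Independence is assumed for disjoint sets only, hence the passage to the atoms of the algebra
  generated by \<open>\<A>\<close>.
\<close>

lemma prm_indep_cylinder:
  assumes prm: "poisson_random_measure P \<Lambda> N"
    and B: "B \<in> sets \<Lambda>" "B \<inter> T = {}"
    and \<A>: "finite \<A>" "\<And>A. A \<in> \<A> \<Longrightarrow> A \<in> sets \<Lambda>" "\<And>A. A \<in> \<A> \<Longrightarrow> A \<subseteq> T"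
    and V: "\<And>A. A \<in> \<A> \<Longrightarrow> V A \<in> sets borel"
    and E: "E = {\<omega>\<in>space P. \<forall>A\<in>\<A>. emeasure (N \<omega>) A \<in> V A}"
  shows "(\<integral>\<^sup>+\<omega>. indicator E \<omega> * emeasure (N \<omega>) B \<partial>P) =
    emeasure P E * (\<integral>\<^sup>+\<omega>. emeasure (N \<omega>) B \<partial>P)"
proof -
  interpret prob_space P using prm by (rule prm_prob_space)
  define atom where "atom S = {x \<in> \<Union>\<A>. {A\<in>\<A>. x \<in> A} = S}" for S
  \<comment> \<open>\<open>None\<close> stands for \<open>B\<close>, \<open>Some S\<close> for an
    atom. Atoms lie in \<open>T\<close> and so avoid \<open>B\<close>; all these sets together form
    one finite disjoint family.\<close>
  define C where "C i = (case i of None \<Rightarrow> B | Some S \<Rightarrow> atom S)" for i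
  define I where "I = Some ` Pow \<A>"
  have atom_sets: "atom S \<in> sets \<Lambda>" if "S \<subseteq> \<A>" for S
  proof -
    have "atom S = \<Union>\<A> \<inter> {x\<in>space \<Lambda>. \<forall>A\<in>\<A>. x \<in> A \<longleftrightarrow> A \<in> S}"
      using that sets.sets_into_space[OF \<A>(2)] unfolding atom_def by blast
    also have "\<dots> \<in> sets \<Lambda>"
    proof (rule sets.Int)
      show "\<Union>\<A> \<in> sets \<Lambda>" using \<A> by auto
      show "{x\<in>space \<Lambda>. \<forall>A\<in>\<A>. x \<in> A \<longleftrightarrow> A \<in> S} \<in> sets \<Lambda>"
        using \<A>(1,2) by (intro sets.sets_Collect_finite_All) (auto simp: pred_def)
    qed
    finally show ?thesis .
  qed
  have decomp: "emeasure (N \<omega>) A = (\<Sum>S\<in>{S\<in>Pow \<A>. A \<in> S}. emeasure (N \<omega>) (atom S))"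
    if "\<omega> \<in> space P" "A \<in> \<A>" for \<omega> A
  proof -
    have "A = (\<Union>S\<in>{S\<in>Pow \<A>. A \<in> S}. atom S)"
      using that unfolding atom_def by auto
    then show ?thesis
      using \<A>(1) atom_sets prm_sets[OF prm that(1)]
      by (subst sum_emeasure) (auto simp: atom_def disjoint_family_on_def)
  qed
  have "indep_vars (\<lambda>_. borel) (\<lambda>i \<omega>. emeasure (N \<omega>) (C i)) (insert None I)"
  proof (rule prm_indep_vars[OF prm])
    show "C i \<in> sets \<Lambda>" if "i \<in> insert None I" for i
      using that B atom_sets by (auto simp: C_def I_def)
    show "disjoint_family_on C (insert None I)"
      using B(2) \<A>(3) unfolding disjoint_family_on_def C_def I_def atom_def by auto
  qed (use \<A>(1) in \<open>auto simp: I_def\<close>)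
  then have "indep_var (PiM I (\<lambda>_. borel)) (\<lambda>\<omega>. restrict (\<lambda>i. emeasure (N \<omega>) (C i)) I)
      (PiM {None} (\<lambda>_. borel)) (\<lambda>\<omega>. restrict (\<lambda>i. emeasure (N \<omega>) (C i)) {None})"
    by (rule indep_var_restrict) (auto simp: I_def)
  moreover
  \<comment> \<open>By \<open>decomp\<close> each count of a member of \<open>\<A>\<close> is a sum
    of atom counts. So \<open>E\<close> is the event \<open>?Q\<close> in the \<open>Some\<close>
    coordinates, which are independent of the \<open>None\<close> coordinate.\<close>
  let ?Q = "{f \<in> space (PiM I (\<lambda>_. borel)). \<forall>A\<in>\<A>. (\<Sum>S\<in>{S\<in>Pow \<A>. A \<in> S}. f (Some S)) \<in> V A}"
  have "?Q \<in> sets (PiM I (\<lambda>_. borel :: ennreal measure))"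
  proof (intro sets.sets_Collect_finite_All \<A>(1))
    fix A assume "A \<in> \<A>"
    note [measurable] = V[OF this]
    have [measurable]: "(\<lambda>f. f (Some S)) \<in> borel_measurable (PiM I (\<lambda>_. borel :: ennreal measure))"
      if "S \<in> {S\<in>Pow \<A>. A \<in> S}" for S
      using that by (intro measurable_component_singleton) (auto simp: I_def)
    show "{f \<in> space (PiM I (\<lambda>_. borel)). (\<Sum>S\<in>{S\<in>Pow \<A>. A \<in> S}. f (Some S)) \<in> V A}
        \<in> sets (PiM I (\<lambda>_. borel :: ennreal measure))"
      by measurable
  qed
  then have "(indicator ?Q :: _ \<Rightarrow> ennreal) \<in> borel_measurable (PiM I (\<lambda>_. borel))"
    by simp
  moreover have "(\<lambda>f. f None) \<in> borel_measurable (PiM {None} (\<lambda>_. borel :: ennreal measure))"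
    by (rule measurable_component_singleton) auto
  ultimately have "indep_var borel (indicator ?Q \<circ> (\<lambda>\<omega>. restrict (\<lambda>i. emeasure (N \<omega>) (C i)) I))
      borel ((\<lambda>f. f None) \<circ> (\<lambda>\<omega>. restrict (\<lambda>i. emeasure (N \<omega>) (C i)) {None}))"
    by (rule indep_var_compose)
  note indep_var_nn_integral[OF this]
  moreover have "(indicator ?Q \<circ> (\<lambda>\<omega>. restrict (\<lambda>i. emeasure (N \<omega>) (C i)) I)) \<omega> =
      (indicator E \<omega> :: ennreal)" if "\<omega> \<in> space P" for \<omega>
  proof -
    have "(\<Sum>S\<in>{S\<in>Pow \<A>. A \<in> S}. restrict (\<lambda>i. emeasure (N \<omega>) (C i)) I (Some S)) =
        emeasure (N \<omega>) A" if "A \<in> \<A>" for A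
      unfolding decomp[OF \<open>\<omega> \<in> space P\<close> that]
      by (intro sum.cong) (auto simp: C_def I_def)
    then show ?thesis
      using that by (auto simp: E indicator_def space_PiM)
  qed
  then have "(\<integral>\<^sup>+\<omega>. (indicator ?Q \<circ> (\<lambda>\<omega>. restrict (\<lambda>i. emeasure (N \<omega>) (C i)) I)) \<omega> * c \<omega> \<partial>P) =
      (\<integral>\<^sup>+\<omega>. indicator E \<omega> * c \<omega> \<partial>P)" for c :: "_ \<Rightarrow> ennreal"
    by (intro nn_integral_cong) simp
  \<comment> \<open>The weight 1 gives the factor \<open>emeasure P E\<close>, the weight
    \<open>emeasure (N \<omega>) B\<close> the joint integral.\<close>
  note this[of "\<lambda>_. 1"] this[of "\<lambda>\<omega>. emeasure (N \<omega>) B"]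
  moreover have "E \<in> sets P"
    unfolding E
  proof (intro sets.sets_Collect_finite_All \<A>(1))
    fix A assume "A \<in> \<A>"
    note [measurable] = V[OF this] prm_measurable[OF prm \<A>(2)[OF this]]
    show "{\<omega> \<in> space P. emeasure (N \<omega>) A \<in> V A} \<in> events"
      by measurable
  qed
  ultimately show ?thesis
    by (simp add: C_def comp_def)
qed

text \<open>A pi-lambda argument: the events in \<open>\<G>\<close>, which constrain finitely many
  counts inside \<open>T\<close>, are closed under intersection and generate the past. On them the
  claim is the cylinder case together with the mean of the count.\<close>

lemma prm_indep_integral:
  fixes N :: "'w \<Rightarrow> 'a measure"
  assumes prm: "poisson_random_measure P \<Lambda> N"
    and B: "B \<in> sets \<Lambda>" "B \<inter> T = {}" "emeasure \<Lambda> B < \<infinity>"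
    and E: "E \<in> sigma_sets (space P) {(\<lambda>\<omega>. emeasure (N \<omega>) A) -` V \<inter> space P | A V.
      A \<in> sets \<Lambda> \<and> A \<subseteq> T \<and> V \<in> sets borel}"
  shows "(\<integral>\<^sup>+\<omega>. indicator E \<omega> * emeasure (N \<omega>) B \<partial>P) = emeasure P E * emeasure \<Lambda> B"
proof -
  interpret prob_space P using prm by (rule prm_prob_space)
  note [measurable] = prm_measurable[OF prm B(1)]
  define \<G> where "\<G> = {{\<omega>\<in>space P. \<forall>A\<in>\<A>. emeasure (N \<omega>) A \<in> V A} | \<A> V.
      finite \<A> \<and> (\<forall>A\<in>\<A>. A \<in> sets \<Lambda> \<and> A \<subseteq> T \<and> V A \<in> sets (borel :: ennreal measure))}"
  have "Int_stable \<G>"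
  proof (rule Int_stableI)
    fix X Y assume "X \<in> \<G>" "Y \<in> \<G>"
    then obtain \<A> V \<A>' V' where
      X: "X = {\<omega>\<in>space P. \<forall>A\<in>\<A>. emeasure (N \<omega>) A \<in> V A}" "finite \<A>"
        "\<forall>A\<in>\<A>. A \<in> sets \<Lambda> \<and> A \<subseteq> T \<and> V A \<in> sets (borel :: ennreal measure)" and
      Y: "Y = {\<omega>\<in>space P. \<forall>A\<in>\<A>'. emeasure (N \<omega>) A \<in> V' A}" "finite \<A>'"
        "\<forall>A\<in>\<A>'. A \<in> sets \<Lambda> \<and> A \<subseteq> T \<and> V' A \<in> sets (borel :: ennreal measure)"
      unfolding \<G>_def by blast
    \<comment> \<open>A set counted in only one of the two events gets the trivial condition
      \<open>UNIV\<close> from the other.\<close>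
    let ?V = "\<lambda>A. (if A \<in> \<A> then V A else UNIV) \<inter> (if A \<in> \<A>' then V' A else UNIV)"
    have "X \<inter> Y = {\<omega>\<in>space P. \<forall>A\<in>\<A>\<union>\<A>'. emeasure (N \<omega>) A \<in> ?V A}"
      unfolding X(1) Y(1) by auto
    moreover have "\<forall>A\<in>\<A>\<union>\<A>'. A \<in> sets \<Lambda> \<and> A \<subseteq> T \<and> ?V A \<in> sets (borel :: ennreal measure)"
      using X(3) Y(3) by auto
    ultimately show "X \<inter> Y \<in> \<G>"
      using X(2) Y(2) unfolding \<G>_def
      by (intro CollectI exI[of _ "\<A> \<union> \<A>'"] exI[of _ ?V]) auto
  qed
  moreover have "\<G> \<subseteq> Pow (space P)"
    unfolding \<G>_def by auto
  moreover have "E \<in> sigma_sets (space P) \<G>"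
  proof (rule sigma_sets_mono'[THEN subsetD, OF _ E], safe)
    fix A V assume *: "A \<in> sets \<Lambda>" "A \<subseteq> T" "V \<in> sets (borel :: ennreal measure)"
    have "(\<lambda>\<omega>. emeasure (N \<omega>) A) -` V \<inter> space P =
        {\<omega>\<in>space P. \<forall>A'\<in>{A}. emeasure (N \<omega>) A' \<in> (\<lambda>_. V) A'}"
      by auto
    then show "(\<lambda>\<omega>. emeasure (N \<omega>) A) -` V \<inter> space P \<in> \<G>"
      unfolding \<G>_def using * by (intro CollectI exI[of _ "{A}"] exI[of _ "\<lambda>_. V"]) auto
  qed
  \<comment> \<open>Measurability is part of the induction because the complement and union steps
    integrate the indicators.\<close>
  ultimately have "E \<in> sets P \<and>
    (\<integral>\<^sup>+\<omega>. indicator E \<omega> * emeasure (N \<omega>) B \<partial>P) = emeasure P E * emeasure \<Lambda> B"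
  proof (induction rule: sigma_sets_induct_disjoint)
    case (basic E)
    then obtain \<A> V where E: "E = {\<omega>\<in>space P. \<forall>A\<in>\<A>. emeasure (N \<omega>) A \<in> V A}" "finite \<A>"
        "\<And>A. A \<in> \<A> \<Longrightarrow> A \<in> sets \<Lambda>" "\<And>A. A \<in> \<A> \<Longrightarrow> A \<subseteq> T"
        "\<And>A. A \<in> \<A> \<Longrightarrow> V A \<in> sets borel"
      unfolding \<G>_def by blast
    have "E \<in> sets P"
      unfolding E(1)
    proof (intro sets.sets_Collect_finite_All E(2))
      fix A assume "A \<in> \<A>"
      note [measurable] = E(5)[OF this] prm_measurable[OF prm E(3)[OF this]]
      show "{\<omega> \<in> space P. emeasure (N \<omega>) A \<in> V A} \<in> events"
        by measurable
    qed
    with prm_indep_cylinder[OF prm B(1,2) E(2,3,4,5,1)] prm_mean[OF prm B(1,3)]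
    show ?case by simp
  next
    case empty
    show ?case by simp
  next
    case (compl E)
    then have [measurable]: "E \<in> sets P" by simp
    have "(\<integral>\<^sup>+\<omega>. indicator E \<omega> * emeasure (N \<omega>) B \<partial>P) +
        (\<integral>\<^sup>+\<omega>. indicator (space P - E) \<omega> * emeasure (N \<omega>) B \<partial>P) =
        (\<integral>\<^sup>+\<omega>. indicator E \<omega> * emeasure (N \<omega>) B +
          indicator (space P - E) \<omega> * emeasure (N \<omega>) B \<partial>P)"
      by (rule nn_integral_add[symmetric]) auto
    also have "\<dots> = (\<integral>\<^sup>+\<omega>. emeasure (N \<omega>) B \<partial>P)"
      by (intro nn_integral_cong) (auto split: split_indicator)
    also have "\<dots> = (emeasure P E + emeasure P (space P - E)) * emeasure \<Lambda> B"
    proof -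
      have "emeasure P E + emeasure P (space P - E) = emeasure P (E \<union> (space P - E))"
        by (rule plus_emeasure) auto
      also have "E \<union> (space P - E) = space P"
        using sets.sets_into_space[of E P] by auto
      finally show ?thesis
        using prm_mean[OF prm B(1,3)] by (simp add: emeasure_space_1)
    qed
    finally have *: "emeasure P E * emeasure \<Lambda> B +
        (\<integral>\<^sup>+\<omega>. indicator (space P - E) \<omega> * emeasure (N \<omega>) B \<partial>P) =
        emeasure P E * emeasure \<Lambda> B + emeasure P (space P - E) * emeasure \<Lambda> B"
      using compl by (simp add: distrib_right)
    \<comment> \<open>Only a finite summand can be cancelled in \<open>ennreal\<close>; this is
      where the finite intensity of \<open>B\<close> enters.\<close>
    moreover have "emeasure P E * emeasure \<Lambda> B \<noteq> \<infinity>"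
      using B(3) by (simp add: ennreal_mult_eq_top_iff)
    ultimately show ?case
      by (simp add: ennreal_add_left_cancel)
  next
    case (union E)
    then have [measurable]: "E i \<in> sets P" for i by simp
    have "(\<integral>\<^sup>+\<omega>. indicator (\<Union>i. E i) \<omega> * emeasure (N \<omega>) B \<partial>P) =
        (\<integral>\<^sup>+\<omega>. (\<Sum>i. indicator (E i) \<omega> * emeasure (N \<omega>) B) \<partial>P)"
      by (simp add: suminf_indicator[OF union(1)])
    also have "\<dots> = (\<Sum>i. \<integral>\<^sup>+\<omega>. indicator (E i) \<omega> * emeasure (N \<omega>) B \<partial>P)"
      by (intro nn_integral_suminf) auto
    also have "\<dots> = (\<Sum>i. emeasure P (E i)) * emeasure \<Lambda> B"
      using union by simp
    also have "(\<Sum>i. emeasure P (E i)) = emeasure P (\<Union>i. E i)"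
      using union(1) by (intro suminf_emeasure) auto
    finally show ?case by auto
  qed
  then show ?thesis by simp
qed

section \<open>Kernels with equal expectations\<close>

text \<open>Dynkin's argument for the mean measures of two kernels on \<omega>-sections. Cutting
  down to \<open>E n\<close> makes complements differences of finite quantities. The space itself is
  listed beside \<open>G\<close> because a family of rectangles bounded in time does not contain it,
  yet complements are taken relative to it.\<close>

lemma kernel_sections_eq:
  fixes K L :: "'w \<Rightarrow> 'a measure" and E :: "nat \<Rightarrow> 'a set"
  assumes sets_K: "\<And>\<omega>. \<omega> \<in> space P \<Longrightarrow> sets (K \<omega>) = sets \<Lambda>"
    and sets_L: "\<And>\<omega>. \<omega> \<in> space P \<Longrightarrow> sets (L \<omega>) = sets \<Lambda>"
    and h: "\<And>\<omega>. \<omega> \<in> space P \<Longrightarrow> h \<omega> \<in> measurable \<Lambda> Q"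
    and G: "Int_stable G" "G \<subseteq> Pow (space Q)" "sets Q = sigma_sets (space Q) G"
    and E: "range E \<subseteq> sets \<Lambda>"
    and fin_K: "\<And>n \<omega>. \<omega> \<in> space P \<Longrightarrow> emeasure (K \<omega>) (E n) < \<infinity>"
    and fin_L: "\<And>n \<omega>. \<omega> \<in> space P \<Longrightarrow> emeasure (L \<omega>) (E n) < \<infinity>"
    and fin: "\<And>n. (\<integral>\<^sup>+\<omega>. emeasure (L \<omega>) (E n) \<partial>P) < \<infinity>"
    and meas_K: "\<And>n X. X \<in> insert (space Q) G \<Longrightarrow>
      (\<lambda>\<omega>. emeasure (K \<omega>) (h \<omega> -` X \<inter> E n)) \<in> borel_measurable P"
    and meas_L: "\<And>n X. X \<in> insert (space Q) G \<Longrightarrow>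
      (\<lambda>\<omega>. emeasure (L \<omega>) (h \<omega> -` X \<inter> E n)) \<in> borel_measurable P"
    and eq: "\<And>n X. X \<in> insert (space Q) G \<Longrightarrow>
      (\<integral>\<^sup>+\<omega>. emeasure (K \<omega>) (h \<omega> -` X \<inter> E n) \<partial>P) =
      (\<integral>\<^sup>+\<omega>. emeasure (L \<omega>) (h \<omega> -` X \<inter> E n) \<partial>P)"
    and X: "X \<in> sets Q"
  shows "(\<lambda>\<omega>. emeasure (K \<omega>) (h \<omega> -` X \<inter> E n)) \<in> borel_measurable P \<and>
    (\<lambda>\<omega>. emeasure (L \<omega>) (h \<omega> -` X \<inter> E n)) \<in> borel_measurable P \<and>
    (\<integral>\<^sup>+\<omega>. emeasure (K \<omega>) (h \<omega> -` X \<inter> E n) \<partial>P) =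
    (\<integral>\<^sup>+\<omega>. emeasure (L \<omega>) (h \<omega> -` X \<inter> E n) \<partial>P)"
proof -
  have E_sets: "E n \<in> sets \<Lambda>" for n using E by auto
  have sec: "h \<omega> -` X \<inter> E n \<in> sets \<Lambda>" if "\<omega> \<in> space P" "X \<in> sets Q" for \<omega> X n
  proof -
    have "h \<omega> -` X \<inter> E n = (h \<omega> -` X \<inter> space \<Lambda>) \<inter> E n"
      using sets.sets_into_space[OF E_sets] by auto
    then show ?thesis
      using measurable_sets[OF h[OF that(1)] that(2)] E_sets by auto
  qed
  have full: "h \<omega> -` space Q \<inter> E n = E n" if "\<omega> \<in> space P" for \<omega> n
    using measurable_space[OF h[OF that]] sets.sets_into_space[OF E_sets[of n]] by auto
  \<comment> \<open>Stated for any kernel \<open>M\<close>, to serve both \<open>K\<close> and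
    \<open>L\<close>. The complement becomes a difference, first for each \<omega> and then in
    expectation, and finiteness is used both times.\<close>
  have compl_meas: "(\<lambda>\<omega>. emeasure (M \<omega>) (h \<omega> -` (space Q - X) \<inter> E n)) \<in> borel_measurable P \<and>
      (\<integral>\<^sup>+\<omega>. emeasure (M \<omega>) (h \<omega> -` (space Q - X) \<inter> E n) \<partial>P) =
      (\<integral>\<^sup>+\<omega>. emeasure (M \<omega>) (h \<omega> -` space Q \<inter> E n) \<partial>P) -
      (\<integral>\<^sup>+\<omega>. emeasure (M \<omega>) (h \<omega> -` X \<inter> E n) \<partial>P)"
    if X: "X \<in> sets Q"
      and M: "\<And>\<omega>. \<omega> \<in> space P \<Longrightarrow> sets (M \<omega>) = sets \<Lambda>"
        "\<And>n \<omega>. \<omega> \<in> space P \<Longrightarrow> emeasure (M \<omega>) (E n) < \<infinity>"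
      and [measurable]: "(\<lambda>\<omega>. emeasure (M \<omega>) (h \<omega> -` X \<inter> E n)) \<in> borel_measurable P"
        "(\<lambda>\<omega>. emeasure (M \<omega>) (h \<omega> -` space Q \<inter> E n)) \<in> borel_measurable P"
      and I: "(\<integral>\<^sup>+\<omega>. emeasure (M \<omega>) (h \<omega> -` space Q \<inter> E n) \<partial>P) < \<infinity>"
    for X n and M :: "'w \<Rightarrow> 'a measure"
  proof -
    have le: "emeasure (M \<omega>) (h \<omega> -` X \<inter> E n) \<le> emeasure (M \<omega>) (h \<omega> -` space Q \<inter> E n)"
      if "\<omega> \<in> space P" for \<omega>
      using that E_sets M(1)[OF that] by (subst full) (auto intro: emeasure_mono)
    have *: "emeasure (M \<omega>) (h \<omega> -` (space Q - X) \<inter> E n) =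
      emeasure (M \<omega>) (h \<omega> -` space Q \<inter> E n) - emeasure (M \<omega>) (h \<omega> -` X \<inter> E n)"
      if "\<omega> \<in> space P" for \<omega>
    proof -
      have "h \<omega> -` (space Q - X) \<inter> E n = (h \<omega> -` space Q \<inter> E n) - (h \<omega> -` X \<inter> E n)"
        by auto
      moreover have "emeasure (M \<omega>) (h \<omega> -` X \<inter> E n) \<noteq> \<infinity>"
        using le[OF that] M(2)[OF that, of n] by (auto simp: full[OF that])
      moreover have "h \<omega> -` X \<inter> E n \<subseteq> h \<omega> -` space Q \<inter> E n"
        using sets.sets_into_space[OF X] by auto
      ultimately show ?thesis
        using sec[OF that, of X n] X M(1)[OF that] sec[OF that, of "space Q" n]
        by (simp add: emeasure_Diff)
    qed
    have "(\<lambda>\<omega>. emeasure (M \<omega>) (h \<omega> -` (space Q - X) \<inter> E n)) \<in> borel_measurable P"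
      by (subst measurable_cong[OF *]) auto
    moreover have "(\<integral>\<^sup>+\<omega>. emeasure (M \<omega>) (h \<omega> -` (space Q - X) \<inter> E n) \<partial>P) =
      (\<integral>\<^sup>+\<omega>. emeasure (M \<omega>) (h \<omega> -` space Q \<inter> E n) - emeasure (M \<omega>) (h \<omega> -` X \<inter> E n) \<partial>P)"
      by (rule nn_integral_cong) (rule *)
    moreover have "(\<integral>\<^sup>+\<omega>. emeasure (M \<omega>) (h \<omega> -` X \<inter> E n) \<partial>P) \<noteq> \<infinity>"
    proof -
      have "(\<integral>\<^sup>+\<omega>. emeasure (M \<omega>) (h \<omega> -` X \<inter> E n) \<partial>P) \<le>
          (\<integral>\<^sup>+\<omega>. emeasure (M \<omega>) (h \<omega> -` space Q \<inter> E n) \<partial>P)"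
        by (intro nn_integral_mono le)
      with I show ?thesis by auto
    qed
    then have "(\<integral>\<^sup>+\<omega>. emeasure (M \<omega>) (h \<omega> -` space Q \<inter> E n) - emeasure (M \<omega>) (h \<omega> -` X \<inter> E n) \<partial>P) =
      (\<integral>\<^sup>+\<omega>. emeasure (M \<omega>) (h \<omega> -` space Q \<inter> E n) \<partial>P) -
      (\<integral>\<^sup>+\<omega>. emeasure (M \<omega>) (h \<omega> -` X \<inter> E n) \<partial>P)"
      using le by (intro nn_integral_diff) auto
    ultimately show ?thesis by simp
  qed
  have fin_full: "(\<integral>\<^sup>+\<omega>. emeasure (L \<omega>) (h \<omega> -` space Q \<inter> E n) \<partial>P) < \<infinity>" for n
    using fin[of n] by (simp add: full cong: nn_integral_cong)
  \<comment> \<open>Finite expectation is assumed for \<open>L\<close> only; equality on the whole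
    space passes it on to \<open>K\<close>.\<close>
  note fin_full_K = fin_full[folded eq[OF insertI1]]
  have "\<forall>n. (\<lambda>\<omega>. emeasure (K \<omega>) (h \<omega> -` X \<inter> E n)) \<in> borel_measurable P \<and>
    (\<lambda>\<omega>. emeasure (L \<omega>) (h \<omega> -` X \<inter> E n)) \<in> borel_measurable P \<and>
    (\<integral>\<^sup>+\<omega>. emeasure (K \<omega>) (h \<omega> -` X \<inter> E n) \<partial>P) =
    (\<integral>\<^sup>+\<omega>. emeasure (L \<omega>) (h \<omega> -` X \<inter> E n) \<partial>P)"
    using G(1,2) X[unfolded G(3)]
  proof (induction rule: sigma_sets_induct_disjoint)
    case (basic X)
    then show ?case using meas_K meas_L eq by auto
  next
    case empty
    show ?case by simp
  next
    case (compl X)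
    then have X: "X \<in> sets Q" by (simp add: G(3))
    show ?case
    proof
      fix n
      from compl(2) have ind: "(\<lambda>\<omega>. emeasure (K \<omega>) (h \<omega> -` X \<inter> E n)) \<in> borel_measurable P"
        "(\<lambda>\<omega>. emeasure (L \<omega>) (h \<omega> -` X \<inter> E n)) \<in> borel_measurable P"
        "(\<integral>\<^sup>+\<omega>. emeasure (K \<omega>) (h \<omega> -` X \<inter> E n) \<partial>P) =
          (\<integral>\<^sup>+\<omega>. emeasure (L \<omega>) (h \<omega> -` X \<inter> E n) \<partial>P)"
        by auto
      note cK = compl_meas[OF X sets_K fin_K ind(1) meas_K[OF insertI1] fin_full_K]
        and cL = compl_meas[OF X sets_L fin_L ind(2) meas_L[OF insertI1] fin_full]
      show "(\<lambda>\<omega>. emeasure (K \<omega>) (h \<omega> -` (space Q - X) \<inter> E n)) \<in> borel_measurable P \<and>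
        (\<lambda>\<omega>. emeasure (L \<omega>) (h \<omega> -` (space Q - X) \<inter> E n)) \<in> borel_measurable P \<and>
        (\<integral>\<^sup>+\<omega>. emeasure (K \<omega>) (h \<omega> -` (space Q - X) \<inter> E n) \<partial>P) =
        (\<integral>\<^sup>+\<omega>. emeasure (L \<omega>) (h \<omega> -` (space Q - X) \<inter> E n) \<partial>P)"
        using cK cL ind(3) eq[OF insertI1, of n] by simp
    qed
  next
    case (union X)
    then have X: "X i \<in> sets Q" for i by (auto simp: G(3))
    have sum: "emeasure (M \<omega>) (h \<omega> -` (\<Union>i. X i) \<inter> E n) = (\<Sum>i. emeasure (M \<omega>) (h \<omega> -` X i \<inter> E n))"
      if "\<omega> \<in> space P" "sets (M \<omega>) = sets \<Lambda>" for n \<omega> and M :: "'w \<Rightarrow> 'a measure"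
    proof -
      have "h \<omega> -` (\<Union>i. X i) \<inter> E n = (\<Union>i. h \<omega> -` X i \<inter> E n)" by auto
      moreover have "disjoint_family (\<lambda>i. h \<omega> -` X i \<inter> E n)"
        using union(1) unfolding disjoint_family_on_def by auto
      ultimately show ?thesis
        using sec[OF that(1) X] that(2) by (simp add: image_subset_iff suminf_emeasure)
    qed
    show ?case
    proof
      fix n
      have [measurable]: "\<And>i. (\<lambda>\<omega>. emeasure (K \<omega>) (h \<omega> -` X i \<inter> E n)) \<in> borel_measurable P"
        "\<And>i. (\<lambda>\<omega>. emeasure (L \<omega>) (h \<omega> -` X i \<inter> E n)) \<in> borel_measurable P"
        and ind: "\<And>i. (\<integral>\<^sup>+\<omega>. emeasure (K \<omega>) (h \<omega> -` X i \<inter> E n) \<partial>P) =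
          (\<integral>\<^sup>+\<omega>. emeasure (L \<omega>) (h \<omega> -` X i \<inter> E n) \<partial>P)"
        using union(3) by auto
      note sK = sum[of _ K, OF _ sets_K] and sL = sum[of _ L, OF _ sets_L]
      show "(\<lambda>\<omega>. emeasure (K \<omega>) (h \<omega> -` (\<Union>i. X i) \<inter> E n)) \<in> borel_measurable P \<and>
        (\<lambda>\<omega>. emeasure (L \<omega>) (h \<omega> -` (\<Union>i. X i) \<inter> E n)) \<in> borel_measurable P \<and>
        (\<integral>\<^sup>+\<omega>. emeasure (K \<omega>) (h \<omega> -` (\<Union>i. X i) \<inter> E n) \<partial>P) =
        (\<integral>\<^sup>+\<omega>. emeasure (L \<omega>) (h \<omega> -` (\<Union>i. X i) \<inter> E n) \<partial>P)"
      proof (intro conjI)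
        show "(\<lambda>\<omega>. emeasure (K \<omega>) (h \<omega> -` (\<Union>i. X i) \<inter> E n)) \<in> borel_measurable P"
          by (subst measurable_cong[OF sK]) auto
        show "(\<lambda>\<omega>. emeasure (L \<omega>) (h \<omega> -` (\<Union>i. X i) \<inter> E n)) \<in> borel_measurable P"
          by (subst measurable_cong[OF sL]) auto
        have "(\<integral>\<^sup>+\<omega>. emeasure (K \<omega>) (h \<omega> -` (\<Union>i. X i) \<inter> E n) \<partial>P) =
          (\<integral>\<^sup>+\<omega>. (\<Sum>i. emeasure (K \<omega>) (h \<omega> -` X i \<inter> E n)) \<partial>P)"
          by (intro nn_integral_cong sK) auto
        also have "\<dots> = (\<integral>\<^sup>+\<omega>. (\<Sum>i. emeasure (L \<omega>) (h \<omega> -` X i \<inter> E n)) \<partial>P)"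
          using ind by (simp add: nn_integral_suminf)
        also have "\<dots> = (\<integral>\<^sup>+\<omega>. emeasure (L \<omega>) (h \<omega> -` (\<Union>i. X i) \<inter> E n) \<partial>P)"
          by (intro nn_integral_cong sL[symmetric]) auto
        finally show "(\<integral>\<^sup>+\<omega>. emeasure (K \<omega>) (h \<omega> -` (\<Union>i. X i) \<inter> E n) \<partial>P) =
          (\<integral>\<^sup>+\<omega>. emeasure (L \<omega>) (h \<omega> -` (\<Union>i. X i) \<inter> E n) \<partial>P)" .
      qed
    qed
  qed
  then show ?thesis by auto
qed

text \<open>The extension from sets to nonnegative functions. Measurability in \<omega> of the inner
  integrals is carried along, since additivity and monotone convergence of the outer integral depend
  on it.\<close>

lemma kernel_nn_integral_eq:
  fixes K L :: "'w \<Rightarrow> 'a measure" and E :: "nat \<Rightarrow> 'a set" and f :: "'q \<Rightarrow> ennreal"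
  assumes sets_K: "\<And>\<omega>. \<omega> \<in> space P \<Longrightarrow> sets (K \<omega>) = sets \<Lambda>"
    and sets_L: "\<And>\<omega>. \<omega> \<in> space P \<Longrightarrow> sets (L \<omega>) = sets \<Lambda>"
    and h: "\<And>\<omega>. \<omega> \<in> space P \<Longrightarrow> h \<omega> \<in> measurable \<Lambda> Q"
    and E: "disjoint_family E" "range E \<subseteq> sets \<Lambda>" "\<Union>(range E) = space \<Lambda>"
    and sections: "\<And>n X. X \<in> sets Q \<Longrightarrow>
      (\<lambda>\<omega>. emeasure (K \<omega>) (h \<omega> -` X \<inter> E n)) \<in> borel_measurable P \<and>
      (\<lambda>\<omega>. emeasure (L \<omega>) (h \<omega> -` X \<inter> E n)) \<in> borel_measurable P \<and>
      (\<integral>\<^sup>+\<omega>. emeasure (K \<omega>) (h \<omega> -` X \<inter> E n) \<partial>P) =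
      (\<integral>\<^sup>+\<omega>. emeasure (L \<omega>) (h \<omega> -` X \<inter> E n) \<partial>P)"
    and f: "f \<in> borel_measurable Q"
  shows "(\<integral>\<^sup>+\<omega>. (\<integral>\<^sup>+x. f (h \<omega> x) \<partial>K \<omega>) \<partial>P) = (\<integral>\<^sup>+\<omega>. (\<integral>\<^sup>+x. f (h \<omega> x) \<partial>L \<omega>) \<partial>P)"
proof -
  have meas: "(\<lambda>x. f (h \<omega> x)) \<in> borel_measurable (M \<omega>)"
    if "\<omega> \<in> space P" "sets (M \<omega>) = sets \<Lambda>" "f \<in> borel_measurable Q"
    for \<omega> and M :: "'w \<Rightarrow> 'a measure" and f :: "'q \<Rightarrow> ennreal"
    using measurable_compose[OF h[OF that(1)] that(3)] measurable_cong_sets[OF that(2) refl] by auto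
  note mK = meas[of _ K, OF _ sets_K] and mL = meas[of _ L, OF _ sets_L]
  \<comment> \<open>The identities for inner integrals hold only for \<omega> in
    \<open>space P\<close>, so measurability and expectation are moved across together instead of
    rewriting the functions.\<close>
  have transfer: "a \<in> borel_measurable P \<and> b \<in> borel_measurable P \<and>
      (\<integral>\<^sup>+\<omega>. a \<omega> \<partial>P) = (\<integral>\<^sup>+\<omega>. b \<omega> \<partial>P)"
    if "\<And>\<omega>. \<omega> \<in> space P \<Longrightarrow> a \<omega> = a' \<omega>" "\<And>\<omega>. \<omega> \<in> space P \<Longrightarrow> b \<omega> = b' \<omega>"
      "a' \<in> borel_measurable P" "b' \<in> borel_measurable P"
      "(\<integral>\<^sup>+\<omega>. a' \<omega> \<partial>P) = (\<integral>\<^sup>+\<omega>. b' \<omega> \<partial>P)"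
    for a b a' b' :: "'w \<Rightarrow> ennreal"
    using that measurable_cong[of P a a' borel] measurable_cong[of P b b' borel]
      nn_integral_cong[of P a a'] nn_integral_cong[of P b b'] by auto
  from f have "(\<lambda>\<omega>. \<integral>\<^sup>+x. f (h \<omega> x) \<partial>K \<omega>) \<in> borel_measurable P \<and>
    (\<lambda>\<omega>. \<integral>\<^sup>+x. f (h \<omega> x) \<partial>L \<omega>) \<in> borel_measurable P \<and>
    (\<integral>\<^sup>+\<omega>. (\<integral>\<^sup>+x. f (h \<omega> x) \<partial>K \<omega>) \<partial>P) = (\<integral>\<^sup>+\<omega>. (\<integral>\<^sup>+x. f (h \<omega> x) \<partial>L \<omega>) \<partial>P)"
  proof (induction f rule: borel_measurable_induct)
    case (cong f g)
    have "(\<integral>\<^sup>+x. f (h \<omega> x) \<partial>M \<omega>) = (\<integral>\<^sup>+x. g (h \<omega> x) \<partial>M \<omega>)"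
      if "\<omega> \<in> space P" "sets (M \<omega>) = sets \<Lambda>" for \<omega> and M :: "'w \<Rightarrow> 'a measure"
      using measurable_space[OF h[OF that(1)]] sets_eq_imp_space_eq[OF that(2)]
      by (intro nn_integral_cong cong(3)) auto
    note eqs = this[of _ K, OF _ sets_K] this[of _ L, OF _ sets_L]
    show ?case
      by (rule transfer[OF eqs]) (use cong(4) in auto)
  next
    case (set X)
    \<comment> \<open>Here the pieces \<open>E n\<close> are reassembled: equality on each piece
      becomes equality on the whole section.\<close>
    have sum: "(\<integral>\<^sup>+x. indicator X (h \<omega> x) \<partial>M \<omega>) = (\<Sum>n. emeasure (M \<omega>) (h \<omega> -` X \<inter> E n))"
      if \<omega>: "\<omega> \<in> space P" and M: "sets (M \<omega>) = sets \<Lambda>" for \<omega> and M :: "'w \<Rightarrow> 'a measure"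
    proof -
      have X: "h \<omega> -` X \<inter> space \<Lambda> \<in> sets (M \<omega>)"
        using measurable_sets[OF h[OF \<omega>] set] M by simp
      have "(\<integral>\<^sup>+x. indicator X (h \<omega> x) \<partial>M \<omega>) = (\<integral>\<^sup>+x. indicator (h \<omega> -` X \<inter> space \<Lambda>) x \<partial>M \<omega>)"
        using sets_eq_imp_space_eq[OF M] by (intro nn_integral_cong) (auto split: split_indicator)
      also have "\<dots> = emeasure (M \<omega>) (\<Union>n. h \<omega> -` X \<inter> E n)"
      proof -
        have "(\<Union>n. h \<omega> -` X \<inter> E n) = h \<omega> -` X \<inter> space \<Lambda>"
          unfolding E(3)[symmetric] by auto
        with X show ?thesis by simp
      qed
      also have "\<dots> = (\<Sum>n. emeasure (M \<omega>) (h \<omega> -` X \<inter> E n))"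
      proof (rule suminf_emeasure[symmetric])
        have "h \<omega> -` X \<inter> E n = (h \<omega> -` X \<inter> space \<Lambda>) \<inter> E n" for n
          using E(3) by auto
        then show "range (\<lambda>n. h \<omega> -` X \<inter> E n) \<subseteq> sets (M \<omega>)"
          using X E(2) M by auto
        show "disjoint_family (\<lambda>n. h \<omega> -` X \<inter> E n)"
          using E(1) unfolding disjoint_family_on_def by auto
      qed
      finally show ?thesis .
    qed
    note eqs = sum[of _ K, OF _ sets_K] sum[of _ L, OF _ sets_L]
    note [measurable] = sections[OF set, THEN conjunct1] sections[OF set, THEN conjunct2, THEN conjunct1]
    have "(\<integral>\<^sup>+\<omega>. (\<Sum>n. emeasure (K \<omega>) (h \<omega> -` X \<inter> E n)) \<partial>P) =
        (\<integral>\<^sup>+\<omega>. (\<Sum>n. emeasure (L \<omega>) (h \<omega> -` X \<inter> E n)) \<partial>P)"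
      using sections[OF set] by (simp add: nn_integral_suminf)
    then show ?case
      by (intro transfer[OF eqs]) auto
  next
    case (mult u c)
    have eqs: "(\<integral>\<^sup>+x. c * u (h \<omega> x) \<partial>K \<omega>) = c * (\<integral>\<^sup>+x. u (h \<omega> x) \<partial>K \<omega>)"
      "(\<integral>\<^sup>+x. c * u (h \<omega> x) \<partial>L \<omega>) = c * (\<integral>\<^sup>+x. u (h \<omega> x) \<partial>L \<omega>)"
      if "\<omega> \<in> space P" for \<omega>
      using mK[OF that that mult(2)] mL[OF that that mult(2)] by (auto intro: nn_integral_cmult)
    show ?case
      by (rule transfer[OF eqs]) (use mult in \<open>auto simp: nn_integral_cmult\<close>)
  next
    case (add u v)
    have eqs: "(\<integral>\<^sup>+x. v (h \<omega> x) + u (h \<omega> x) \<partial>K \<omega>) = (\<integral>\<^sup>+x. v (h \<omega> x) \<partial>K \<omega>) + (\<integral>\<^sup>+x. u (h \<omega> x) \<partial>K \<omega>)"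
      "(\<integral>\<^sup>+x. v (h \<omega> x) + u (h \<omega> x) \<partial>L \<omega>) = (\<integral>\<^sup>+x. v (h \<omega> x) \<partial>L \<omega>) + (\<integral>\<^sup>+x. u (h \<omega> x) \<partial>L \<omega>)"
      if "\<omega> \<in> space P" for \<omega>
      using mK[OF that that add(1)] mL[OF that that add(1)] mK[OF that that add(3)] mL[OF that that add(3)]
      by (auto intro: nn_integral_add)
    show ?case
      by (rule transfer[OF eqs]) (use add in \<open>auto simp: nn_integral_add\<close>)
  next
    case (seq U)
    \<comment> \<open>Monotone convergence acts twice: \<open>inc'\<close> serves the inner integral
      at a fixed \<omega>, \<open>inc\<close> the outer one.\<close>
    have inc: "incseq (\<lambda>i. \<integral>\<^sup>+x. U i (h \<omega> x) \<partial>M \<omega>)" for \<omega> and M :: "'w \<Rightarrow> 'a measure"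
      using seq(3) by (auto simp: incseq_def le_fun_def intro!: nn_integral_mono)
    have inc': "incseq (\<lambda>i x. U i (h \<omega> x))" for \<omega>
      using seq(3) by (auto simp: incseq_def le_fun_def)
    have "(\<integral>\<^sup>+x. (SUP i. U i) (h \<omega> x) \<partial>K \<omega>) = (SUP i. \<integral>\<^sup>+x. U i (h \<omega> x) \<partial>K \<omega>)"
      "(\<integral>\<^sup>+x. (SUP i. U i) (h \<omega> x) \<partial>L \<omega>) = (SUP i. \<integral>\<^sup>+x. U i (h \<omega> x) \<partial>L \<omega>)"
      if "\<omega> \<in> space P" for \<omega>
      using mK[OF that that seq(1)] mL[OF that that seq(1)]
      by (simp_all add: SUP_apply image_comp nn_integral_monotone_convergence_SUP[OF inc'])
    note eqs = this
    note [measurable] = seq.IH[THEN conjunct1] seq.IH[THEN conjunct2, THEN conjunct1]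
    have "(\<integral>\<^sup>+\<omega>. (SUP i. \<integral>\<^sup>+x. U i (h \<omega> x) \<partial>K \<omega>) \<partial>P) =
        (\<integral>\<^sup>+\<omega>. (SUP i. \<integral>\<^sup>+x. U i (h \<omega> x) \<partial>L \<omega>) \<partial>P)"
      using seq.IH inc
      by (subst (1 2) nn_integral_monotone_convergence_SUP) (auto simp: incseq_def le_fun_def)
    then show ?case
      by (intro transfer[OF eqs]) auto
  qed
  then show ?thesis by simp
qed

section \<open>The predictable sigma-algebra\<close>

lemma space_noise_filtration [simp]: "space (noise_filtration P \<mu> N t) = space P"
  unfolding noise_filtration_def by (intro space_measure_of) auto

lemma sets_noise_filtration:
  "sets (noise_filtration P \<mu> N t) = sigma_sets (space P)
    {(\<lambda>\<omega>. emeasure (N \<omega>) A) -` B \<inter> space P | A B.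
      A \<in> sets (intensity \<mu>) \<and> A \<subseteq> {0..t} \<times> UNIV \<and> B \<in> sets borel}"
  unfolding noise_filtration_def by (intro sets_measure_of) auto

lemma noise_filtration_mono:
  fixes \<mu> :: "(real ^ 'd) measure"
  assumes "s \<le> t"
  shows "sets (noise_filtration P \<mu> N s) \<subseteq> sets (noise_filtration P \<mu> N t)"
  unfolding sets_noise_filtration
proof (rule sigma_sets_mono', safe)
  fix A :: "(real \<times> (real ^ 'd) \<times> (real ^ 'd)) set" and B :: "ennreal set"
  assume "A \<in> sets (intensity \<mu>)" "A \<subseteq> {0..s} \<times> UNIV" "B \<in> sets borel"
  moreover have "{0..s} \<times> UNIV \<subseteq> {0..t} \<times> (UNIV :: ((real ^ 'd) \<times> (real ^ 'd)) set)"
    using assms by auto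
  ultimately show "\<exists>A' B'. (\<lambda>\<omega>. emeasure (N \<omega>) A) -` B \<inter> space P =
      (\<lambda>\<omega>. emeasure (N \<omega>) A') -` B' \<inter> space P \<and>
      A' \<in> sets (intensity \<mu>) \<and> A' \<subseteq> {0..t} \<times> UNIV \<and> B' \<in> sets borel"
    by (intro exI[of _ A] exI[of _ B] conjI refl) (auto 0 2)
qed

lemma noise_filtration_subalgebra:
  assumes "poisson_random_measure P (intensity \<mu>) N"
  shows "sets (noise_filtration P \<mu> N t) \<subseteq> sets P"
  unfolding sets_noise_filtration
  by (intro sets.sigma_sets_subset) (auto intro!: measurable_sets[OF prm_measurable[OF assms]])

text \<open>The generator of \<open>predictable_sigma\<close>, named for inductions. The intervals
  are open on the left: the event is known at time \<open>a\<close>, while the points of the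
  interval come strictly later. The slices at 0 supply the one time that no such interval
  reaches.\<close>

definition predictable_generators :: "'w set \<Rightarrow> (real \<Rightarrow> 'w measure) \<Rightarrow> ('w \<times> real) set set" where
  "predictable_generators \<Omega> F =
     {A \<times> {a<..b} | A a b. 0 \<le> a \<and> a < b \<and> A \<in> sets (F a)} \<union> {A \<times> {0} | A. A \<in> sets (F 0)}"

lemma predictable_generatorsE:
  assumes "R \<in> predictable_generators \<Omega> F"
  obtains (interval) A a b where "R = A \<times> {a<..b}" "0 \<le> a" "a < b" "A \<in> sets (F a)"
    | (zero) A where "R = A \<times> {0}" "A \<in> sets (F 0)"
  using assms unfolding predictable_generators_def by blast

lemma predictable_generators_interval:
  assumes "0 \<le> a" "A \<in> sets (F a)"
  shows "A \<times> {a<..b} \<in> predictable_generators \<Omega> F"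
proof (cases "a < b")
  case True
  then show ?thesis using assms unfolding predictable_generators_def by blast
next
  case False
  \<comment> \<open>Degenerate intervals are covered because the empty set is the zero slice of the
    empty event.\<close>
  then have "A \<times> {a<..b} = {} \<times> {0}" by auto
  then show ?thesis unfolding predictable_generators_def by blast
qed

lemma predictable_generators_zero:
  "A \<in> sets (F 0) \<Longrightarrow> A \<times> {0} \<in> predictable_generators \<Omega> F"
  unfolding predictable_generators_def by blast

text \<open>Two intervals meet in one that starts at the later left endpoint, and by monotonicity
  both events are already known there. An interval never meets the zero slice.\<close>

lemma Int_stable_predictable_generators:
  assumes mono: "\<And>s t. s \<le> t \<Longrightarrow> sets (F s) \<subseteq> sets (F t)"
  shows "Int_stable (predictable_generators \<Omega> F)"
proof (rule Int_stableI)
  fix R R' assume R: "R \<in> predictable_generators \<Omega> F" and R': "R' \<in> predictable_generators \<Omega> F"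
  have empty: "{} \<in> predictable_generators \<Omega> F"
    using predictable_generators_zero[of "{}" F] by simp
  from R show "R \<inter> R' \<in> predictable_generators \<Omega> F"
  proof (cases rule: predictable_generatorsE)
    case 1: (interval A a b)
    from R' show ?thesis
    proof (cases rule: predictable_generatorsE)
      case 2: (interval A' a' b')
      have "R \<inter> R' = (A \<inter> A') \<times> {max a a'<..min b b'}"
        unfolding 1(1) 2(1) by auto
      moreover have "A \<in> sets (F (max a a'))" "A' \<in> sets (F (max a a'))"
        using 1(4) 2(4) mono[of a "max a a'"] mono[of a' "max a a'"] by auto
      ultimately show ?thesis
        using 1(2) by (auto intro!: predictable_generators_interval)
    next
      case 2: (zero A')
      have "R \<inter> R' = {}" unfolding 1(1) 2(1) using 1(2) by auto
      then show ?thesis using empty by simp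
    qed
  next
    case 1: (zero A)
    from R' show ?thesis
    proof (cases rule: predictable_generatorsE)
      case 2: (interval A' a' b')
      have "R \<inter> R' = {}" unfolding 1(1) 2(1) using 2(2) by auto
      then show ?thesis using empty by simp
    next
      case 2: (zero A')
      have "R \<inter> R' = (A \<inter> A') \<times> {0}" unfolding 1(1) 2(1) by auto
      then show ?thesis using 1(2) 2(2) by (auto intro!: predictable_generators_zero)
    qed
  qed
qed

context
  fixes \<Omega> :: "'w set" and F :: "real \<Rightarrow> 'w measure"
  assumes space_F: "\<And>t. space (F t) = \<Omega>"
begin

lemma predictable_generators_subset:
  "predictable_generators \<Omega> F \<subseteq> Pow (\<Omega> \<times> {0..})"
proof
  fix R assume "R \<in> predictable_generators \<Omega> F"
  then show "R \<in> Pow (\<Omega> \<times> {0..})"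
  proof (cases rule: predictable_generatorsE)
    case (interval A a b)
    then show ?thesis using sets.sets_into_space[OF interval(4)] by (auto simp: space_F)
  next
    case (zero A)
    then show ?thesis using sets.sets_into_space[OF zero(2)] by (auto simp: space_F)
  qed
qed

lemma space_predictable_sigma: "space (predictable_sigma \<Omega> F) = \<Omega> \<times> {0..}"
  unfolding predictable_sigma_def
  by (intro space_measure_of predictable_generators_subset[unfolded predictable_generators_def])

lemma sets_predictable_sigma:
  "sets (predictable_sigma \<Omega> F) = sigma_sets (\<Omega> \<times> {0..}) (predictable_generators \<Omega> F)"
  unfolding predictable_sigma_def predictable_generators_def
  by (intro sets_measure_of predictable_generators_subset[unfolded predictable_generators_def])

text \<open>For fixed \<omega> the event of a rectangle is either true or false, so its time section
  is an interval, a point or empty. This makes pathwise integration of predictable functions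
  possible.\<close>

lemma measurable_predictable_section:
  assumes "\<omega> \<in> \<Omega>"
  shows "(\<lambda>s. (\<omega>, s)) \<in> measurable (restrict_space borel {0..}) (predictable_sigma \<Omega> F)"
proof (rule measurable_sigma_sets[OF sets_predictable_sigma predictable_generators_subset])
  show "(\<lambda>s. (\<omega>, s)) \<in> space (restrict_space borel {0..}) \<rightarrow> \<Omega> \<times> {0..}"
    using assms by (auto simp: space_restrict_space)
  fix R assume "R \<in> predictable_generators \<Omega> F"
  then show "(\<lambda>s. (\<omega>, s)) -` R \<inter> space (restrict_space borel {0..}) \<in>
      sets (restrict_space borel {0..})"
  proof (cases rule: predictable_generatorsE)
    case (interval A a b)
    then have "(\<lambda>s. (\<omega>, s)) -` R \<inter> space (restrict_space borel {0..}) =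
        {0..} \<inter> (if \<omega> \<in> A then {a<..b} else {})"
      by (auto simp: space_restrict_space)
    then show ?thesis by (auto simp: sets_restrict_space)
  next
    case (zero A)
    then have "(\<lambda>s. (\<omega>, s)) -` R \<inter> space (restrict_space borel {0..}) =
        {0..} \<inter> (if \<omega> \<in> A then {0} else {})"
      by (auto simp: space_restrict_space)
    then show ?thesis by (auto simp: sets_restrict_space)
  qed
qed

text \<open>Predictable sets are jointly measurable in \<omega> and time; this is what allows the
  order of expectation and intensity to be exchanged.\<close>

lemma measurable_to_predictable_sigma:
  assumes sub: "\<And>t. sets (F t) \<subseteq> sets P" and sp: "space P = \<Omega>"
  shows "(\<lambda>x. x) \<in> measurable (P \<Otimes>\<^sub>M restrict_space borel {0..}) (predictable_sigma \<Omega> F)"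
proof (rule measurable_sigma_sets[OF sets_predictable_sigma predictable_generators_subset])
  show "(\<lambda>x. x) \<in> space (P \<Otimes>\<^sub>M restrict_space borel {0..}) \<rightarrow> \<Omega> \<times> {0..}"
    by (auto simp: space_restrict_space space_pair_measure sp)
  fix R assume R: "R \<in> predictable_generators \<Omega> F"
  then have "R \<in> sets (P \<Otimes>\<^sub>M restrict_space borel {0..})"
  proof (cases rule: predictable_generatorsE)
    case (interval A a b)
    have "{a<..b} \<in> sets (restrict_space borel {0..})"
      unfolding sets_restrict_space using interval(2) by (intro image_eqI[of _ _ "{a<..b}"]) auto
    then show ?thesis using interval sub by auto
  next
    case (zero A)
    have "{0::real} \<in> sets (restrict_space borel {0..})"
      unfolding sets_restrict_space by (rule image_eqI[of _ _ "{0}"]) auto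
    then show ?thesis using zero sub by auto
  qed
  moreover from R have "R \<subseteq> space (P \<Otimes>\<^sub>M restrict_space borel {0..})"
    using predictable_generators_subset by (auto simp: space_restrict_space space_pair_measure sp)
  ultimately show "(\<lambda>x. x) -` R \<inter> space (P \<Otimes>\<^sub>M restrict_space borel {0..}) \<in>
      sets (P \<Otimes>\<^sub>M restrict_space borel {0..})"
    by (simp add: Int_absorb2)
qed

lemma sets_predictable_pair:
  "sets (predictable_sigma \<Omega> F \<Otimes>\<^sub>M S) = sigma_sets ((\<Omega> \<times> {0..}) \<times> space S)
    {R \<times> W | R W. R \<in> predictable_generators \<Omega> F \<and> W \<in> sets S}"
proof -
  \<comment> \<open>Products of generators generate the product sigma-algebra once countably many
    generators cover the space; the zero slice and the intervals up to \<open>n\<close> do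
    so.\<close>
  let ?C = "insert (\<Omega> \<times> {0}) (range (\<lambda>n::nat. \<Omega> \<times> {0<..real n}))"
  have \<Omega>: "\<Omega> \<in> sets (F 0)" using sets.top[of "F 0"] by (simp add: space_F)
  have "\<Union>?C = \<Omega> \<times> {0..}"
  proof (intro set_eqI iffI)
    fix x :: "'w \<times> real" assume "x \<in> \<Omega> \<times> {0..}"
    moreover obtain n :: nat where "snd x \<le> real n" using real_arch_simple by blast
    ultimately show "x \<in> \<Union>?C" by (cases "snd x = 0") (auto intro!: exI[of _ n])
  qed auto
  moreover have "?C \<subseteq> predictable_generators \<Omega> F"
    using \<Omega> by (auto intro: predictable_generators_interval predictable_generators_zero)
  ultimately have "sets (predictable_sigma \<Omega> F \<Otimes>\<^sub>M S) =
      sets (sigma (space (predictable_sigma \<Omega> F) \<times> space S)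
        {R \<times> W | R W. R \<in> predictable_generators \<Omega> F \<and> W \<in> sets S})"
    using predictable_generators_subset
    by (intro sets_pair_eq[where Ca="?C" and Cb="{space S}"])
      (auto simp: space_predictable_sigma sets_predictable_sigma sets.sigma_sets_eq
        dest: sets.sets_into_space)
  also have "\<dots> = sigma_sets ((\<Omega> \<times> {0..}) \<times> space S)
      {R \<times> W | R W. R \<in> predictable_generators \<Omega> F \<and> W \<in> sets S}"
    unfolding space_predictable_sigma using predictable_generators_subset
    by (intro sets_measure_of) (blast dest: sets.sets_into_space)
  finally show ?thesis .
qed

end

section \<open>Campbell's formula for predictable integrands\<close>

lemma levy_measureD:
  assumes "levy_measure \<mu>"
  shows "sets \<mu> = sets borel" "sigma_finite_measure \<mu>"
  using assms unfolding levy_measure_def by auto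

lemma sets_intensity:
  assumes "levy_measure \<mu>"
  shows "sets (intensity \<mu>) = sets (restrict_space borel {0..} \<Otimes>\<^sub>M (borel \<Otimes>\<^sub>M borel))"
  unfolding intensity_def
  by (intro sets_pair_measure_cong sets_restrict_space_cong)
    (simp_all add: levy_measureD(1)[OF assms])

lemma space_intensity:
  assumes "levy_measure \<mu>"
  shows "space (intensity \<mu>) = {0..} \<times> UNIV"
  using sets_eq_imp_space_eq[OF sets_intensity[OF assms]]
  by (simp add: space_pair_measure space_restrict_space)

lemma sigma_finite_restrict_lborel: "sigma_finite_measure (restrict_space lborel {0::real..})"
  by (intro sigma_finite_measure_restrict_space lborel.sigma_finite_measure_axioms) auto

lemma sigma_finite_intensity:
  fixes \<mu> :: "(real ^ 'd) measure"
  assumes "levy_measure \<mu>"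
  shows "sigma_finite_measure (intensity \<mu>)"
  unfolding intensity_def
  by (intro sigma_finite_pair_measure sigma_finite_restrict_lborel
    lborel.sigma_finite_measure_axioms levy_measureD(2)[OF assms])

text \<open>Needed for the generators over time 0, whose events are not separated in time from the
  points being counted.\<close>

lemma intensity_zero_time:
  fixes \<mu> :: "(real ^ 'd) measure"
  assumes "levy_measure \<mu>" "B \<subseteq> {0} \<times> UNIV"
  shows "emeasure (intensity \<mu>) B = 0"
proof -
  interpret \<mu>: sigma_finite_measure \<mu> using levy_measureD(2)[OF assms(1)] .
  interpret S': sigma_finite_measure "(lborel :: (real ^ 'd) measure) \<Otimes>\<^sub>M \<mu>"
    by (intro sigma_finite_pair_measure lborel.sigma_finite_measure_axioms
      \<mu>.sigma_finite_measure_axioms)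
  have sp: "space \<mu> = UNIV"
    using sets_eq_imp_space_eq[OF levy_measureD(1)[OF assms(1)]] by simp
  have z: "{0} \<in> sets (restrict_space lborel {0::real..})"
    by (subst sets_restrict_space_iff) auto
  have t: "UNIV \<in> sets ((lborel :: (real ^ 'd) measure) \<Otimes>\<^sub>M \<mu>)"
    using sets.top[of "(lborel :: (real ^ 'd) measure) \<Otimes>\<^sub>M \<mu>"] by (simp add: space_pair_measure sp)
  have "emeasure (intensity \<mu>) B \<le> emeasure (intensity \<mu>) ({0} \<times> UNIV)"
    using assms(2) z t unfolding intensity_def by (intro emeasure_mono) auto
  also have "\<dots> = emeasure (restrict_space lborel {0::real..}) {0} *
      emeasure ((lborel :: (real ^ 'd) measure) \<Otimes>\<^sub>M \<mu>) UNIV"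
    unfolding intensity_def by (rule S'.emeasure_pair_measure_Times[OF z t])
  also have "emeasure (restrict_space lborel {0::real..}) {0} = 0"
    by (subst emeasure_restrict_space) auto
  finally show ?thesis by simp
qed

lemma predictable_campbell:
  fixes \<mu> :: "(real ^ 'd) measure"
    and f :: "('w \<times> real) \<times> ((real ^ 'd) \<times> (real ^ 'd)) \<Rightarrow> ennreal"
  assumes levy: "levy_measure \<mu>" and prm: "poisson_random_measure P (intensity \<mu>) N"
    and f: "f \<in> borel_measurable
      (predictable_sigma (space P) (noise_filtration P \<mu> N) \<Otimes>\<^sub>M (borel \<Otimes>\<^sub>M borel))"
  shows "(\<integral>\<^sup>+\<omega>. (\<integral>\<^sup>+z. f ((\<omega>, fst z), snd z) \<partial>N \<omega>) \<partial>P) =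
    (\<integral>\<^sup>+\<omega>. (\<integral>\<^sup>+z. f ((\<omega>, fst z), snd z) \<partial>intensity \<mu>) \<partial>P)"
proof -
  interpret prob_space P using prm by (rule prm_prob_space)
  define F where "F = noise_filtration P \<mu> N"
  define S where "S = (borel \<Otimes>\<^sub>M borel :: ((real ^ 'd) \<times> (real ^ 'd)) measure)"
  define Q where "Q = predictable_sigma (space P) F \<Otimes>\<^sub>M S"
  \<comment> \<open>\<open>h \<omega>\<close> regroups a point so that time stands next to \<omega>,
    as predictability requires; preimages under it are \<omega>-sections.\<close>
  define h where "h \<omega> z = ((\<omega>, fst z), snd z)" for \<omega> :: 'w and z :: "real \<times> (real ^ 'd) \<times> (real ^ 'd)"
  define \<Lambda> where "\<Lambda> = intensity \<mu>"
  define G where "G = {R \<times> W | R W. R \<in> predictable_generators (space P) F \<and> W \<in> sets S}"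
  note prm = prm[folded \<Lambda>_def]
  have sF: "space (F t) = space P" for t by (simp add: F_def)
  have sub: "sets (F t) \<subseteq> sets P" for t
    unfolding F_def using prm[unfolded \<Lambda>_def] by (rule noise_filtration_subalgebra)
  have sets_\<Lambda>: "sets \<Lambda> = sets (restrict_space borel {0..} \<Otimes>\<^sub>M S)"
    unfolding \<Lambda>_def S_def by (rule sets_intensity[OF levy])
  have space_\<Lambda>: "space \<Lambda> = {0..} \<times> UNIV"
    unfolding \<Lambda>_def by (rule space_intensity[OF levy])
  have space_S: "space S = UNIV" by (simp add: S_def space_pair_measure)
  interpret \<Lambda>: sigma_finite_measure \<Lambda>
    unfolding \<Lambda>_def by (rule sigma_finite_intensity[OF levy])
  obtain E :: "nat \<Rightarrow> (real \<times> (real ^ 'd) \<times> (real ^ 'd)) set" where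
    E: "range E \<subseteq> sets \<Lambda>" "\<Union>(range E) = space \<Lambda>" "\<And>n. emeasure \<Lambda> (E n) \<noteq> \<infinity>" "disjoint_family E"
    using \<Lambda>.sigma_finite_disjoint by blast
  have E_sets: "E n \<in> sets \<Lambda>" for n using E(1) by auto
  have E_fin: "emeasure \<Lambda> (E n) < \<infinity>" for n using E(3) by (simp add: less_top)
  \<comment> \<open>The monotone class argument needs finiteness on \<open>E n\<close> for every \<open>\<omega>\<close>, while \<open>N\<close>
    only has it almost surely.\<close>
  define K where "K \<omega> = (if \<forall>n. emeasure (N \<omega>) (E n) < \<infinity> then N \<omega> else null_measure \<Lambda>)" for \<omega>
  have sets_K: "sets (K \<omega>) = sets \<Lambda>" if "\<omega> \<in> space P" for \<omega>
    using prm_sets[OF prm that] by (simp add: K_def)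
  have fin_K: "emeasure (K \<omega>) (E n) < \<infinity>" for \<omega> n
    by (simp add: K_def)
  have meas_K: "(\<lambda>\<omega>. emeasure (K \<omega>) A) \<in> borel_measurable P" if A: "A \<in> sets \<Lambda>" for A
  proof -
    note [measurable] = prm_measurable[OF prm A] prm_measurable[OF prm E_sets]
    have "(\<lambda>\<omega>. emeasure (K \<omega>) A) =
        (\<lambda>\<omega>. if \<forall>n. emeasure (N \<omega>) (E n) < \<infinity> then emeasure (N \<omega>) A else 0)"
      by (auto simp: K_def fun_eq_iff)
    then show ?thesis by simp
  qed
  have AE_K: "AE \<omega> in P. K \<omega> = N \<omega>"
  proof -
    have "AE \<omega> in P. \<forall>n. emeasure (N \<omega>) (E n) < \<infinity>"
      unfolding AE_all_countable
    proof
      fix n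
      show "AE \<omega> in P. emeasure (N \<omega>) (E n) < \<infinity>"
        using prm_finite[OF prm E_sets E_fin, of n]
        by eventually_elim (auto simp: of_nat_less_top)
    qed
    then show ?thesis by eventually_elim (simp add: K_def)
  qed
  have h: "h \<omega> \<in> measurable \<Lambda> Q" if "\<omega> \<in> space P" for \<omega>
  proof -
    note [measurable] = measurable_predictable_section[OF sF that]
    have "h \<omega> \<in> measurable (restrict_space borel {0..} \<Otimes>\<^sub>M S) Q"
      unfolding h_def Q_def by measurable
    then show ?thesis
      using measurable_cong_sets[OF sets_\<Lambda> refl] by blast
  qed
  have G: "Int_stable G"
  proof (rule Int_stableI)
    fix X Y assume "X \<in> G" "Y \<in> G"
    then obtain R W R' W' where *: "X = R \<times> W" "Y = R' \<times> W'"
      "R \<in> predictable_generators (space P) F" "R' \<in> predictable_generators (space P) F"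
      "W \<in> sets S" "W' \<in> sets S"
      unfolding G_def by blast
    have "R \<inter> R' \<in> predictable_generators (space P) F"
      using Int_stable_predictable_generators[of F] noise_filtration_mono *(3,4)
      unfolding F_def Int_stable_def by blast
    moreover have "X \<inter> Y = (R \<inter> R') \<times> (W \<inter> W')" using * by auto
    ultimately show "X \<inter> Y \<in> G" unfolding G_def using *(5,6) by blast
  qed
  have space_Q: "space Q = (space P \<times> {0..}) \<times> UNIV"
    by (simp add: Q_def space_pair_measure space_predictable_sigma[OF sF] space_S)
  have sets_Q: "sets Q = sigma_sets (space Q) G"
    unfolding Q_def G_def sets_predictable_pair[OF sF]
    by (simp add: space_pair_measure space_predictable_sigma[OF sF])
  have G_sub: "G \<subseteq> Pow (space Q)"
    unfolding G_def space_Q using predictable_generators_subset[of F "space P", OF sF] by blast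
  \<comment> \<open>On a rectangle the section is a fixed set \<open>B\<close> for \<omega> in
    \<open>A\<close> and empty otherwise. Everything thus reduces to the factorisation
    \<open>int\<close>, stated for \<open>N\<close> and moved to \<open>K\<close> along the almost
    sure equality.\<close>
  have base: "(\<lambda>\<omega>. emeasure (K \<omega>) (h \<omega> -` X \<inter> E n)) \<in> borel_measurable P \<and>
      (\<lambda>\<omega>. emeasure \<Lambda> (h \<omega> -` X \<inter> E n)) \<in> borel_measurable P \<and>
      (\<integral>\<^sup>+\<omega>. emeasure (K \<omega>) (h \<omega> -` X \<inter> E n) \<partial>P) = (\<integral>\<^sup>+\<omega>. emeasure \<Lambda> (h \<omega> -` X \<inter> E n) \<partial>P)"
    if sec: "\<And>\<omega>. \<omega> \<in> space P \<Longrightarrow> h \<omega> -` X \<inter> E n = (if \<omega> \<in> A then B else {})"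
      and [measurable]: "A \<in> sets P" and B: "B \<in> sets \<Lambda>"
      and int: "(\<integral>\<^sup>+\<omega>. indicator A \<omega> * emeasure (N \<omega>) B \<partial>P) = emeasure P A * emeasure \<Lambda> B"
    for X n A B
  proof (intro conjI)
    note [measurable] = meas_K[OF B]
    have ind: "emeasure M (h \<omega> -` X \<inter> E n) = indicator A \<omega> * emeasure M B"
      if "\<omega> \<in> space P" for \<omega> and M :: "(real \<times> (real ^ 'd) \<times> (real ^ 'd)) measure"
      unfolding sec[OF that] by simp
    show "(\<lambda>\<omega>. emeasure (K \<omega>) (h \<omega> -` X \<inter> E n)) \<in> borel_measurable P"
      by (subst measurable_cong[OF ind]) auto
    show "(\<lambda>\<omega>. emeasure \<Lambda> (h \<omega> -` X \<inter> E n)) \<in> borel_measurable P"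
      by (subst measurable_cong[OF ind]) auto
    have "(\<integral>\<^sup>+\<omega>. emeasure (K \<omega>) (h \<omega> -` X \<inter> E n) \<partial>P) =
        (\<integral>\<^sup>+\<omega>. indicator A \<omega> * emeasure (K \<omega>) B \<partial>P)"
      by (rule nn_integral_cong) (rule ind)
    also have "\<dots> = (\<integral>\<^sup>+\<omega>. indicator A \<omega> * emeasure (N \<omega>) B \<partial>P)"
      using AE_K by (intro nn_integral_cong_AE) (auto elim: eventually_mono)
    also have "\<dots> = (\<integral>\<^sup>+\<omega>. indicator A \<omega> * emeasure \<Lambda> B \<partial>P)"
      unfolding int by (simp add: nn_integral_multc)
    also have "\<dots> = (\<integral>\<^sup>+\<omega>. emeasure \<Lambda> (h \<omega> -` X \<inter> E n) \<partial>P)"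
      by (rule nn_integral_cong) (rule ind[symmetric])
    finally show "(\<integral>\<^sup>+\<omega>. emeasure (K \<omega>) (h \<omega> -` X \<inter> E n) \<partial>P) =
        (\<integral>\<^sup>+\<omega>. emeasure \<Lambda> (h \<omega> -` X \<inter> E n) \<partial>P)" .
  qed
  have gens: "(\<lambda>\<omega>. emeasure (K \<omega>) (h \<omega> -` X \<inter> E n)) \<in> borel_measurable P \<and>
      (\<lambda>\<omega>. emeasure \<Lambda> (h \<omega> -` X \<inter> E n)) \<in> borel_measurable P \<and>
      (\<integral>\<^sup>+\<omega>. emeasure (K \<omega>) (h \<omega> -` X \<inter> E n) \<partial>P) = (\<integral>\<^sup>+\<omega>. emeasure \<Lambda> (h \<omega> -` X \<inter> E n) \<partial>P)"
    if X: "X \<in> insert (space Q) G" for X n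
  proof (cases "X = space Q")
    case True
    show ?thesis
    proof (rule base)
      show "h \<omega> -` X \<inter> E n = (if \<omega> \<in> space P then E n else {})" if "\<omega> \<in> space P" for \<omega>
        using that sets.sets_into_space[OF E_sets[of n]] unfolding True space_Q space_\<Lambda>
        by (auto simp: h_def)
      show "(\<integral>\<^sup>+\<omega>. indicator (space P) \<omega> * emeasure (N \<omega>) (E n) \<partial>P) =
          emeasure P (space P) * emeasure \<Lambda> (E n)"
        using prm_mean[OF prm E_sets E_fin, of n]
        by (simp add: emeasure_space_1 cong: nn_integral_cong)
    qed (auto intro: E_sets)
  next
    case False
    with X obtain R W where RW: "X = R \<times> W" "R \<in> predictable_generators (space P) F" "W \<in> sets S"
      unfolding G_def by blast
    have T_sets: "(I \<times> W) \<inter> E n \<in> sets \<Lambda>" if "I \<in> sets borel" "I \<subseteq> {0..}" for I :: "real set"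
    proof -
      have "I \<in> sets (restrict_space borel {0..})"
        using that by (subst sets_restrict_space_iff) auto
      then show ?thesis
        using RW(3) E_sets sets_\<Lambda> by auto
    qed
    have T_fin: "emeasure \<Lambda> ((I \<times> W) \<inter> E n) < \<infinity>" for I :: "real set"
      using emeasure_mono[of "(I \<times> W) \<inter> E n" "E n" \<Lambda>] E_sets E_fin[of n] by (auto intro: le_less_trans)
    from RW(2) show ?thesis
    proof (cases rule: predictable_generatorsE)
      case (interval A a b)
      let ?B = "({a<..b} \<times> W) \<inter> E n"
      have B: "?B \<in> sets \<Lambda>" using interval(2) by (intro T_sets) auto
      show ?thesis
      proof (rule base)
        show "h \<omega> -` X \<inter> E n = (if \<omega> \<in> A then ?B else {})" for \<omega>
          unfolding RW(1) interval(1) by (auto simp: h_def)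
        show "A \<in> sets P" using interval(4) sub by auto
        show "(\<integral>\<^sup>+\<omega>. indicator A \<omega> * emeasure (N \<omega>) ?B \<partial>P) = emeasure P A * emeasure \<Lambda> ?B"
        \<comment> \<open>\<open>T\<close> is the time strip up to \<open>a\<close>, which
          determines \<open>A\<close>; the left-open interval keeps \<open>?B\<close> disjoint from
          it.\<close>
        proof (rule prm_indep_integral[OF prm B _ T_fin])
          show "?B \<inter> ({0..a} \<times> UNIV) = {}" by auto
          show "A \<in> sigma_sets (space P) {(\<lambda>\<omega>. emeasure (N \<omega>) A) -` V \<inter> space P | A V.
              A \<in> sets \<Lambda> \<and> A \<subseteq> {0..a} \<times> UNIV \<and> V \<in> sets borel}"
            using interval(4) unfolding F_def sets_noise_filtration \<Lambda>_def .
        qed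
      qed (rule B)
    next
      case (zero A)
      let ?B = "({0} \<times> W) \<inter> E n"
      have B: "?B \<in> sets \<Lambda>" by (intro T_sets) auto
      \<comment> \<open>In place of independence: since the intensity vanishes, so does the mean
        count, and both sides of the factorisation are 0.\<close>
      have B0: "emeasure \<Lambda> ?B = 0"
        unfolding \<Lambda>_def by (rule intensity_zero_time[OF levy]) auto
      show ?thesis
      proof (rule base)
        show "h \<omega> -` X \<inter> E n = (if \<omega> \<in> A then ?B else {})" for \<omega>
          unfolding RW(1) zero(1) by (auto simp: h_def)
        show "A \<in> sets P" using zero(2) sub by auto
        have "(\<integral>\<^sup>+\<omega>. indicator A \<omega> * emeasure (N \<omega>) ?B \<partial>P) \<le> (\<integral>\<^sup>+\<omega>. emeasure (N \<omega>) ?B \<partial>P)"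
          by (intro nn_integral_mono) (auto split: split_indicator)
        also have "\<dots> = 0"
          using prm_mean[OF prm B T_fin] B0 by simp
        finally show "(\<integral>\<^sup>+\<omega>. indicator A \<omega> * emeasure (N \<omega>) ?B \<partial>P) = emeasure P A * emeasure \<Lambda> ?B"
          using B0 by simp
      qed (rule B)
    qed
  qed
  \<comment> \<open>The second kernel is constantly \<open>\<Lambda>\<close>, so its finiteness
    conditions come down to finite intensity of \<open>E n\<close>, \<open>P\<close> having total
    mass one.\<close>
  have sections: "(\<lambda>\<omega>. emeasure (K \<omega>) (h \<omega> -` X \<inter> E n)) \<in> borel_measurable P \<and>
      (\<lambda>\<omega>. emeasure \<Lambda> (h \<omega> -` X \<inter> E n)) \<in> borel_measurable P \<and>
      (\<integral>\<^sup>+\<omega>. emeasure (K \<omega>) (h \<omega> -` X \<inter> E n) \<partial>P) = (\<integral>\<^sup>+\<omega>. emeasure \<Lambda> (h \<omega> -` X \<inter> E n) \<partial>P)"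
    if "X \<in> sets Q" for X n
    using sets_K refl h G G_sub sets_Q E(1) fin_K E_fin
  proof (rule kernel_sections_eq)
    show "(\<integral>\<^sup>+\<omega>. emeasure \<Lambda> (E n) \<partial>P) < \<infinity>" for n
      using E_fin[of n] by (simp add: emeasure_space_1)
  qed (use gens that in auto)
  have "(\<integral>\<^sup>+\<omega>. (\<integral>\<^sup>+z. f (h \<omega> z) \<partial>N \<omega>) \<partial>P) = (\<integral>\<^sup>+\<omega>. (\<integral>\<^sup>+z. f (h \<omega> z) \<partial>K \<omega>) \<partial>P)"
    using AE_K by (intro nn_integral_cong_AE) (auto elim: eventually_mono)
  also have "\<dots> = (\<integral>\<^sup>+\<omega>. (\<integral>\<^sup>+z. f (h \<omega> z) \<partial>\<Lambda>) \<partial>P)"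
  proof (rule kernel_nn_integral_eq[where E=E and Q=Q and \<Lambda>=\<Lambda>])
    show "f \<in> borel_measurable Q" using f unfolding Q_def F_def S_def .
  qed (use sets_K h E sections in auto)
  finally show ?thesis unfolding h_def \<Lambda>_def .
qed

section \<open>Mass of the Green kernel\<close>

text \<open>
  Measurability and integrability are not needed, since the integral of a non-integrable function
  is 0 by convention.
\<close>

lemma ennreal_abs_integral_le:
  fixes f :: "'a \<Rightarrow> real"
  shows "ennreal \<bar>\<integral>x. f x \<partial>M\<bar> \<le> (\<integral>\<^sup>+x. ennreal \<bar>f x\<bar> \<partial>M)"
proof (cases "integrable M f")
  case True
  from integral_norm_bound_ennreal[OF this] show ?thesis by simp
next
  case False
  then show ?thesis by (simp add: not_integrable_integral_eq)
qed

lemma isotropic_stable_density_nonneg: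
  "isotropic_stable_density \<nu> \<alpha> p \<Longrightarrow> 0 < s \<Longrightarrow> 0 \<le> p s x"
  unfolding isotropic_stable_density_def by auto

lemma isotropic_stable_density_mass:
  fixes p :: "real \<Rightarrow> real ^ 'd \<Rightarrow> real"
  assumes p: "isotropic_stable_density \<nu> \<alpha> p" and s: "0 < s"
  shows "(\<integral>\<^sup>+x. ennreal (p s x) \<partial>lborel) = 1"
proof -
  have "complex_of_real (\<integral>x. p s x \<partial>lborel) = (\<integral>x. complex_of_real (p s x) \<partial>lborel)"
    by simp
  also have "\<dots> = (\<integral>x. cis ((0 :: real ^ 'd) \<bullet> x) * complex_of_real (p s x) \<partial>lborel)"
    by simp
  also have "\<dots> = complex_of_real (exp (- s * \<nu> * norm (0 :: real ^ 'd) powr \<alpha>))"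
    using p s unfolding isotropic_stable_density_def by blast
  \<comment> \<open>Here \<open>0 powr \<alpha>\<close> is 0, so the exponential is 1.\<close>
  also have "\<dots> = complex_of_real 1" by simp
  finally have "(\<integral>x. p s x \<partial>lborel) = 1" by (simp only: of_real_eq_iff)
  moreover have "integrable lborel (p s)"
    using p s unfolding isotropic_stable_density_def by blast
  ultimately show ?thesis
    using isotropic_stable_density_nonneg[OF p s] by (subst nn_integral_eq_integral) auto
qed

lemma stable_subordinator_densityD:
  assumes "stable_subordinator_density \<beta> g"
  shows "0 \<le> g x" "integrable lborel g" "(\<integral>x. g x \<partial>lborel) = 1" "g \<in> borel_measurable borel"
proof -
  \<comment> \<open>The Laplace transform at 0, with \<open>0 powr \<beta> = 0\<close>, gives the
    total mass.\<close>
  have "(\<integral>x. exp (- 0 * x) * g x \<partial>lborel) = exp (- (0 powr \<beta>))"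
    using assms unfolding stable_subordinator_density_def by blast
  then show "(\<integral>x. g x \<partial>lborel) = 1" by simp
  show i: "integrable lborel g"
    using assms unfolding stable_subordinator_density_def by blast
  show "g \<in> borel_measurable borel"
    using borel_measurable_integrable[OF i] by simp
qed (use assms in \<open>auto simp: stable_subordinator_density_def\<close>)

lemma inverse_subordinator_density_nonneg:
  assumes "stable_subordinator_density \<beta> g" "0 < \<beta>" "0 < t"
  shows "0 \<le> inverse_subordinator_density \<beta> g t s"
  using assms stable_subordinator_densityD(1)[OF assms(1)]
  unfolding inverse_subordinator_density_def by simp

text \<open>Substituting \<open>z = t s\<^sup>-\<^sup>1\<^sup>/\<^sup>\<beta>\<close> turns the integral over \<open>s\<close> into the total mass of \<open>g\<close>.\<close>

lemma inverse_subordinator_density_mass: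
  assumes g: "stable_subordinator_density \<beta> g" and \<beta>: "0 < \<beta>" and t: "0 < t"
  shows "(\<integral>\<^sup>+s. indicator {0<..} s * ennreal (inverse_subordinator_density \<beta> g t s) \<partial>lborel) \<le> 1"
proof -
  note gD = stable_subordinator_densityD[OF g]
  note [measurable] = gD(4)
  \<comment> \<open>\<open>\<phi>\<close> is decreasing on the half-line; the modulus of its
    derivative is exactly the prefactor of \<open>g\<close> in the inverse subordinator
    density.\<close>
  define \<phi> where "\<phi> s = t * s powr (- 1 / \<beta>)" for s
  define \<phi>' where "\<phi>' s = - (t / \<beta> * s powr (- 1 - 1 / \<beta>))" for s
  have der: "(\<phi> has_field_derivative \<phi>' s) (at s within {0<..})" if "s \<in> {0<..}" for s
    unfolding \<phi>_def \<phi>'_def using that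
    by (auto intro!: derivative_eq_intros simp: field_simps powr_diff powr_minus)
  have inj: "inj_on \<phi> {0<..}"
  proof (rule inj_onI)
    fix a b :: real assume ab: "a \<in> {0<..}" "b \<in> {0<..}" "\<phi> a = \<phi> b"
    then have "a powr (- 1 / \<beta>) = b powr (- 1 / \<beta>)" using t by (simp add: \<phi>_def)
    then have "(a powr (- 1 / \<beta>)) powr (- \<beta>) = (b powr (- 1 / \<beta>)) powr (- \<beta>)" by simp
    then show "a = b" using ab \<beta> by (simp add: powr_powr)
  qed
  have img: "\<phi> ` {0<..} = {0<..}"
  proof (intro set_eqI iffI)
    fix y :: real assume y: "y \<in> {0<..}"
    \<comment> \<open>The preimage solves \<open>y = t * s powr (- 1 / \<beta>)\<close> for
      \<open>s\<close>.\<close>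
    have "\<phi> ((y / t) powr (- \<beta>)) = y"
      using y t \<beta> by (simp add: \<phi>_def powr_powr)
    then show "y \<in> \<phi> ` {0<..}" using y t by (intro image_eqI[of _ _ "(y / t) powr (- \<beta>)"]) auto
  qed (use t in \<open>auto simp: \<phi>_def\<close>)
  have gi: "set_integrable lborel {0<..} g"
    unfolding set_integrable_def using gD(2) by (intro integrable_mult_indicator) auto
  \<comment> \<open>The change of variables is a statement about Lebesgue measure, hence the passage
    to the completion here and back to \<open>lborel\<close> below.\<close>
  then have gi': "g absolutely_integrable_on {0<..}"
    unfolding set_integrable_def by (intro integrable_completion[THEN iffD2]) auto
  have "(\<lambda>s. \<bar>\<phi>' s\<bar> * g (\<phi> s)) absolutely_integrable_on {0<..} \<and>
      integral {0<..} (\<lambda>s. \<bar>\<phi>' s\<bar> * g (\<phi> s)) = integral {0<..} g"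
    using has_absolute_integral_change_of_variables_1'[of "{0<..}" \<phi> \<phi>' g, OF _ der inj]
      gi' unfolding img by auto
  moreover have eq: "\<bar>\<phi>' s\<bar> * g (\<phi> s) = inverse_subordinator_density \<beta> g t s" if "0 < s" for s
    using t \<beta> that by (simp add: \<phi>_def \<phi>'_def inverse_subordinator_density_def abs_mult)
  ultimately have abs: "set_integrable lebesgue {0<..} (\<lambda>s. \<bar>\<phi>' s\<bar> * g (\<phi> s))"
    and int: "integral {0<..} (\<lambda>s. \<bar>\<phi>' s\<bar> * g (\<phi> s)) = integral {0<..} g"
    by auto
  have "(\<integral>\<^sup>+s. indicator {0<..} s * ennreal (inverse_subordinator_density \<beta> g t s) \<partial>lborel) =
      (\<integral>\<^sup>+s. ennreal (indicator {0<..} s *\<^sub>R (\<bar>\<phi>' s\<bar> * g (\<phi> s))) \<partial>lebesgue)"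
    unfolding nn_integral_completion
    by (intro nn_integral_cong) (auto simp: eq split: split_indicator)
  also have "\<dots> = ennreal (LINT s:{0<..}|lebesgue. \<bar>\<phi>' s\<bar> * g (\<phi> s))"
    using abs gD(1) unfolding set_lebesgue_integral_def set_integrable_def
    by (intro nn_integral_eq_integral) auto
  also have "\<dots> = ennreal (LINT s:{0<..}|lebesgue. g s)"
    using set_lebesgue_integral_eq_integral(2)[OF abs] set_lebesgue_integral_eq_integral(2)[OF gi'] int
    by simp
  also have "\<dots> = ennreal (LINT s:{0<..}|lborel. g s)"
    unfolding set_lebesgue_integral_def by (subst integral_completion) auto
  also have "\<dots> \<le> ennreal (\<integral>s. g s \<partial>lborel)"
    using gi gD(1,2) unfolding set_lebesgue_integral_def set_integrable_def
    by (intro ennreal_leI integral_mono) (auto split: split_indicator)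
  finally show ?thesis by (simp add: gD(3))
qed

text \<open>Continuity is available for positive times only and \<open>p\<close> is unconstrained
  elsewhere, hence the indicator.\<close>

lemma measurable_stable_density:
  fixes p :: "real \<Rightarrow> real ^ 'd \<Rightarrow> real"
  assumes p: "isotropic_stable_density \<nu> \<alpha> p"
  shows "(\<lambda>(s, x). indicator {0<..} s * p s x) \<in> borel_measurable (borel \<Otimes>\<^sub>M borel)"
proof -
  have "open ({0 :: real<..} \<times> (UNIV :: (real ^ 'd) set))"
    by (intro open_Times) auto
  then have "(\<lambda>z. indicator ({0<..} \<times> UNIV) z *\<^sub>R (case z of (s, x) \<Rightarrow> p s x)) \<in>
      borel_measurable (borel :: (real \<times> (real ^ 'd)) measure)"
    using p unfolding isotropic_stable_density_def
    by (intro borel_measurable_continuous_on_indicator) auto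
  then have "(\<lambda>z. indicator ({0<..} \<times> UNIV) z *\<^sub>R (case z of (s, x) \<Rightarrow> p s x)) \<in>
      borel_measurable (borel \<Otimes>\<^sub>M borel :: (real \<times> (real ^ 'd)) measure)"
    unfolding borel_prod .
  moreover have "(\<lambda>z. indicator ({0<..} \<times> UNIV) z *\<^sub>R (case z of (s, x) \<Rightarrow> p s x)) =
      (\<lambda>(s, x). indicator {0<..} s * p s x)"
    by (auto simp: fun_eq_iff split: split_indicator)
  ultimately show ?thesis by simp
qed

lemma measurable_green_kernel:
  fixes p :: "real \<Rightarrow> real ^ 'd \<Rightarrow> real"
  assumes p: "isotropic_stable_density \<nu> \<alpha> p" and g: "stable_subordinator_density \<beta> g"
  shows "(\<lambda>(t, x). green_kernel \<beta> g p t x) \<in> borel_measurable (borel \<Otimes>\<^sub>M borel)"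
proof -
  note [measurable] = stable_subordinator_densityD(4)[OF g] measurable_stable_density[OF p]
  have "(\<lambda>(t, x). \<integral>s. (\<lambda>(s, x). indicator {0<..} s * p s x) (s, x) *
      inverse_subordinator_density \<beta> g t s \<partial>lborel) \<in> borel_measurable (borel \<Otimes>\<^sub>M borel)"
    unfolding inverse_subordinator_density_def by measurable
  then show ?thesis
    by (simp add: green_kernel_def set_lebesgue_integral_def mult.assoc)
qed

text \<open>By Tonelli the space integral of \<open>p s\<close> comes first and equals one, which
  leaves the mass of the inverse subordinator density. The first step is an inequality because the
  kernel takes the default value 0 where its integral diverges.\<close>

lemma green_kernel_mass:
  fixes p :: "real \<Rightarrow> real ^ 'd \<Rightarrow> real"
  assumes p: "isotropic_stable_density \<nu> \<alpha> p" and g: "stable_subordinator_density \<beta> g"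
    and \<beta>: "0 < \<beta>" and t: "0 < t"
  shows "(\<integral>\<^sup>+x. ennreal \<bar>green_kernel \<beta> g p t x\<bar> \<partial>lborel) \<le> 1"
proof -
  let ?f = "inverse_subordinator_density \<beta> g t"
  note [measurable] = stable_subordinator_densityD(4)[OF g] measurable_stable_density[OF p]
  have fm [measurable]: "?f \<in> borel_measurable borel"
    unfolding inverse_subordinator_density_def by measurable
  have pm: "(\<lambda>(s, x). ennreal ((\<lambda>(s, x). indicator {0<..} s * p s x) (s, x)) * ennreal (?f s))
      \<in> borel_measurable (lborel \<Otimes>\<^sub>M lborel)"
    by measurable
  have "(\<integral>\<^sup>+x. ennreal \<bar>green_kernel \<beta> g p t x\<bar> \<partial>lborel) \<le>
      (\<integral>\<^sup>+x. (\<integral>\<^sup>+s. ennreal (indicator {0<..} s * p s x) * ennreal (?f s) \<partial>lborel) \<partial>lborel)"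
  proof (intro nn_integral_mono)
    fix x :: "real ^ 'd"
    have "ennreal \<bar>green_kernel \<beta> g p t x\<bar> \<le>
        (\<integral>\<^sup>+s. ennreal \<bar>indicator {0<..} s *\<^sub>R (p s x * ?f s)\<bar> \<partial>lborel)"
      unfolding green_kernel_def set_lebesgue_integral_def by (rule ennreal_abs_integral_le)
    also have "\<dots> = (\<integral>\<^sup>+s. ennreal (indicator {0<..} s * p s x) * ennreal (?f s) \<partial>lborel)"
      using isotropic_stable_density_nonneg[OF p] inverse_subordinator_density_nonneg[OF g \<beta> t]
      by (intro nn_integral_cong) (auto simp: abs_mult ennreal_mult split: split_indicator)
    finally show "ennreal \<bar>green_kernel \<beta> g p t x\<bar> \<le>
        (\<integral>\<^sup>+s. ennreal (indicator {0<..} s * p s x) * ennreal (?f s) \<partial>lborel)" .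
  qed
  also have "\<dots> = (\<integral>\<^sup>+s. (\<integral>\<^sup>+x. ennreal (indicator {0<..} s * p s x) * ennreal (?f s) \<partial>lborel) \<partial>lborel)"
    using lborel_pair.Fubini'[of "\<lambda>s x. ennreal (indicator {0<..} s * p s x) * ennreal (?f s)"] pm
    by simp
  also have "\<dots> = (\<integral>\<^sup>+s. indicator {0<..} s * ennreal (?f s) \<partial>lborel)"
  proof (intro nn_integral_cong)
    fix s :: real
    have "integrable lborel (p s)" if "0 < s"
      using p that unfolding isotropic_stable_density_def by blast
    then have [measurable]: "p s \<in> borel_measurable borel" if "0 < s"
      using that by (auto dest: borel_measurable_integrable)
    show "(\<integral>\<^sup>+x. ennreal (indicator {0<..} s * p s x) * ennreal (?f s) \<partial>lborel) =
        indicator {0<..} s * ennreal (?f s)"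
    proof (cases "0 < s")
      case True
      then have [measurable]: "p s \<in> borel_measurable borel" by measurable
      show ?thesis
        using True isotropic_stable_density_mass[OF p True] by (simp add: nn_integral_multc)
    qed simp
  qed
  also have "\<dots> \<le> 1" by (rule inverse_subordinator_density_mass[OF g \<beta> t])
  finally show ?thesis .
qed

section \<open>Expectation of the stochastic convolution\<close>

text \<open>Makes the deterministic factor \<open>G (t - s) (y - x)\<close> predictable. A sublevel
  set of time is the zero slice together with one interval.\<close>

lemma measurable_predictable_time:
  assumes space_F: "\<And>t. space (F t) = \<Omega>"
  shows "snd \<in> borel_measurable (predictable_sigma \<Omega> F)"
  unfolding borel_measurable_iff_le
proof
  fix a :: real
  have \<Omega>: "\<Omega> \<in> sets (F 0)" using sets.top[of "F 0"] by (simp add: space_F)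
  have gen: "R \<in> sets (predictable_sigma \<Omega> F)" if "R \<in> predictable_generators \<Omega> F" for R
    using that unfolding sets_predictable_sigma[OF space_F] by (rule sigma_sets.Basic)
  show "{w \<in> space (predictable_sigma \<Omega> F). snd w \<le> a} \<in> sets (predictable_sigma \<Omega> F)"
  proof (cases "0 \<le> a")
    case True
    then have "{w \<in> space (predictable_sigma \<Omega> F). snd w \<le> a} = \<Omega> \<times> {0} \<union> \<Omega> \<times> {0<..a}"
      unfolding space_predictable_sigma[OF space_F] by auto
    also have "\<dots> \<in> sets (predictable_sigma \<Omega> F)"
      using \<Omega> by (intro sets.Un gen predictable_generators_zero predictable_generators_interval) auto
    finally show ?thesis .
  next
    case False
    then have "{w \<in> space (predictable_sigma \<Omega> F). snd w \<le> a} = {}"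
      unfolding space_predictable_sigma[OF space_F] by auto
    then show ?thesis by (simp only: sets.empty_sets)
  qed
qed

lemma norm_1_bound:
  assumes "0 < t"
  shows "(\<integral>\<^sup>+\<omega>. ennreal \<bar>u t x \<omega>\<bar> \<partial>P) \<le> ennreal (exp (\<gamma> * t)) * norm_1 P \<gamma> u"
proof -
  have "ennreal (exp (- \<gamma> * t)) * (\<integral>\<^sup>+\<omega>. ennreal \<bar>u t x \<omega>\<bar> \<partial>P) \<le> norm_1 P \<gamma> u"
    unfolding norm_1_def using assms by (intro SUP_upper2[of t] SUP_upper2[of x]) auto
  then have "ennreal (exp (\<gamma> * t)) * (ennreal (exp (- \<gamma> * t)) * (\<integral>\<^sup>+\<omega>. ennreal \<bar>u t x \<omega>\<bar> \<partial>P)) \<le>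
      ennreal (exp (\<gamma> * t)) * norm_1 P \<gamma> u"
    by (rule mult_left_mono) simp
  moreover have "ennreal (exp (\<gamma> * t)) * ennreal (exp (- \<gamma> * t)) = 1"
    by (simp add: exp_minus flip: ennreal_mult)
  ultimately show ?thesis by (simp flip: mult.assoc)
qed

lemma nn_integral_exp_le:
  fixes \<gamma> t :: real
  assumes "0 < \<gamma>" "0 < t"
  shows "(\<integral>\<^sup>+s. indicator {0<..t} s * ennreal (exp (\<gamma> * s)) \<partial>lborel) \<le> ennreal (exp (\<gamma> * t) / \<gamma>)"
proof -
  have "(\<integral>\<^sup>+s. indicator {0<..t} s * ennreal (exp (\<gamma> * s)) \<partial>lborel) \<le>
      (\<integral>\<^sup>+s. ennreal (exp (\<gamma> * s)) * indicator {0..t} s \<partial>lborel)"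
    by (intro nn_integral_mono) (auto split: split_indicator)
  also have "\<dots> = exp (\<gamma> * t) / \<gamma> - exp (\<gamma> * 0) / \<gamma>"
    using assms
    by (intro nn_integral_FTC_Icc) (auto intro!: derivative_eq_intros simp: has_real_derivative_iff_has_vector_derivative[symmetric])
  also have "\<dots> \<le> ennreal (exp (\<gamma> * t) / \<gamma>)"
    using assms by (intro ennreal_leI) auto
  finally show ?thesis .
qed

lemma nn_integral_lborel_shift:
  fixes f :: "real ^ 'd \<Rightarrow> ennreal"
  assumes [measurable]: "f \<in> borel_measurable borel"
  shows "(\<integral>\<^sup>+y. f (y - x) \<partial>lborel) = (\<integral>\<^sup>+y. f y \<partial>lborel)"
proof -
  have "(\<integral>\<^sup>+y. f y \<partial>lborel) = (\<integral>\<^sup>+y. f y \<partial>distr lborel borel ((+) (- x)))"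
    by (simp add: lborel_distr_plus)
  also have "\<dots> = (\<integral>\<^sup>+y. f (y - x) \<partial>lborel)"
    by (subst nn_integral_distr) auto
  finally show ?thesis ..
qed

text \<open>The factors separate under Tonelli: \<open>J\<close> gives \<open>K\<close>, the kernel
  at most one after a translation that removes \<open>x\<close>, and the time factor the exponential
  bound.\<close>

lemma intensity_integral_bound:
  fixes \<mu> :: "(real ^ 'd) measure" and G :: "real \<Rightarrow> real ^ 'd \<Rightarrow> real"
  assumes levy: "levy_measure \<mu>"
    and G: "(\<lambda>(t, x). G t x) \<in> borel_measurable (borel \<Otimes>\<^sub>M borel)"
    and mass: "\<And>t. 0 < t \<Longrightarrow> (\<integral>\<^sup>+x. ennreal \<bar>G t x\<bar> \<partial>lborel) \<le> 1"
    and J: "integrable \<mu> J" "\<And>h. 0 \<le> J h" "(\<integral>h. J h \<partial>\<mu>) \<le> K"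
    and \<gamma>: "0 < \<gamma>" and t: "0 < t"
  shows "(\<integral>\<^sup>+(s, y, h). indicator {0<..t} s * ennreal (exp (\<gamma> * s)) *
      ennreal \<bar>G (t - s) (y - x)\<bar> * ennreal (J h) \<partial>intensity \<mu>) \<le>
    ennreal (exp (\<gamma> * t) / \<gamma>) * ennreal K"
proof -
  let ?R = "restrict_space lborel {0::real..}"
  interpret \<mu>: sigma_finite_measure \<mu> using levy_measureD(2)[OF levy] .
  interpret S: sigma_finite_measure "(lborel :: (real ^ 'd) measure) \<Otimes>\<^sub>M \<mu>"
    by (intro sigma_finite_pair_measure lborel.sigma_finite_measure_axioms
      \<mu>.sigma_finite_measure_axioms)
  note [measurable] = G borel_measurable_integrable[OF J(1)]
  have Gt [measurable]: "(\<lambda>y. G r y) \<in> borel_measurable borel" for r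
    using measurable_compose[OF measurable_Pair1' G, of r] by simp
  have idR: "(\<lambda>s. s) \<in> measurable ?R borel"
    by (auto intro: measurable_restrict_space1)
  let ?e = "\<lambda>s. indicator {0<..t} s * ennreal (exp (\<gamma> * s))"
  have "(\<integral>\<^sup>+h. ennreal (J h) \<partial>\<mu>) = ennreal (\<integral>h. J h \<partial>\<mu>)"
    using J by (intro nn_integral_eq_integral) auto
  then have J_le: "(\<integral>\<^sup>+h. ennreal (J h) \<partial>\<mu>) \<le> ennreal K"
    using J(3) by (simp add: ennreal_leI)
  have gm: "(\<lambda>z. case z of (s, y, h) \<Rightarrow> ?e s * ennreal \<bar>G (t - s) (y - x)\<bar> * ennreal (J h))
      \<in> borel_measurable (?R \<Otimes>\<^sub>M (lborel \<Otimes>\<^sub>M \<mu>))"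
  proof -
    note [measurable] = idR
    show ?thesis by measurable
  qed
  have "(\<integral>\<^sup>+(s, y, h). ?e s * ennreal \<bar>G (t - s) (y - x)\<bar> * ennreal (J h) \<partial>intensity \<mu>) =
      (\<integral>\<^sup>+s. (\<integral>\<^sup>+(y, h). ?e s * ennreal \<bar>G (t - s) (y - x)\<bar> * ennreal (J h) \<partial>(lborel \<Otimes>\<^sub>M \<mu>)) \<partial>?R)"
    unfolding intensity_def using S.nn_integral_fst[OF gm] by simp
  also have "\<dots> = (\<integral>\<^sup>+s. indicator {0..} s * (\<integral>\<^sup>+(y, h). ?e s * ennreal \<bar>G (t - s) (y - x)\<bar> * ennreal (J h) \<partial>(lborel \<Otimes>\<^sub>M \<mu>)) \<partial>lborel)"
    by (subst nn_integral_restrict_space) (auto simp: mult.commute)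
  also have "\<dots> \<le> (\<integral>\<^sup>+s. ?e s * ennreal K \<partial>lborel)"
  proof (rule nn_integral_mono_AE)
    have "AE s in lborel. s \<noteq> t"
      by (rule AE_lborel_singleton)
    then show "AE s in lborel. indicator {0..} s * (\<integral>\<^sup>+(y, h). ?e s * ennreal \<bar>G (t - s) (y - x)\<bar> *
        ennreal (J h) \<partial>(lborel \<Otimes>\<^sub>M \<mu>)) \<le> ?e s * ennreal K"
    proof eventually_elim
      case (elim s)
      have gms: "(\<lambda>z. case z of (y, h) \<Rightarrow> ?e s * ennreal \<bar>G (t - s) (y - x)\<bar> * ennreal (J h))
          \<in> borel_measurable (lborel \<Otimes>\<^sub>M \<mu>)"
        by measurable
      show ?case
      proof (cases "s \<in> {0<..t}")
        case False
        then show ?thesis by (simp add: case_prod_unfold)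
      next
        case True
        with elim have "0 < t - s" by auto
        have "(\<integral>\<^sup>+(y, h). ?e s * ennreal \<bar>G (t - s) (y - x)\<bar> * ennreal (J h) \<partial>(lborel \<Otimes>\<^sub>M \<mu>)) =
            (\<integral>\<^sup>+y. (\<integral>\<^sup>+h. ?e s * ennreal \<bar>G (t - s) (y - x)\<bar> * ennreal (J h) \<partial>\<mu>) \<partial>lborel)"
          using \<mu>.nn_integral_fst[OF gms] by simp
        also have "\<dots> = ?e s * (\<integral>\<^sup>+y. ennreal \<bar>G (t - s) (y - x)\<bar> \<partial>lborel) * (\<integral>\<^sup>+h. ennreal (J h) \<partial>\<mu>)"
          by (simp add: nn_integral_cmult nn_integral_multc)
        also have "(\<integral>\<^sup>+y. ennreal \<bar>G (t - s) (y - x)\<bar> \<partial>lborel) = (\<integral>\<^sup>+y. ennreal \<bar>G (t - s) y\<bar> \<partial>lborel)"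
          by (rule nn_integral_lborel_shift) simp
        also have "?e s * (\<integral>\<^sup>+y. ennreal \<bar>G (t - s) y\<bar> \<partial>lborel) * (\<integral>\<^sup>+h. ennreal (J h) \<partial>\<mu>) \<le>
            ?e s * 1 * ennreal K"
          using mass[OF \<open>0 < t - s\<close>] J_le by (intro mult_mono order_refl) auto
        finally show ?thesis using True by simp
      qed
    qed
  qed
  also have "\<dots> = (\<integral>\<^sup>+s. ?e s \<partial>lborel) * ennreal K"
    by (rule nn_integral_multc) measurable
  also have "\<dots> \<le> ennreal (exp (\<gamma> * t) / \<gamma>) * ennreal K"
    by (intro mult_right_mono nn_integral_exp_le \<gamma> t) auto
  finally show ?thesis .
qed

text \<open>After Campbell's formula the expectation is moved innermost, so that it concerns
  \<sigma> at one fixed point \<open>(s, y)\<close>, the only place where the norm of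
  \<open>u\<close> gives information.\<close>

lemma stochastic_convolution_expectation_le:
  fixes \<mu> :: "(real ^ 'd) measure" and G :: "real \<Rightarrow> real ^ 'd \<Rightarrow> real"
  assumes levy: "levy_measure \<mu>" and prm: "poisson_random_measure P (intensity \<mu>) N"
    and G: "(\<lambda>(t, x). G t x) \<in> borel_measurable (borel \<Otimes>\<^sub>M borel)"
    and \<sigma>: "(\<lambda>(x, h). \<sigma> x h) \<in> borel_measurable (borel \<Otimes>\<^sub>M borel)"
    and u: "predictable_field P \<mu> N u"
  shows "(\<integral>\<^sup>+\<omega>. ennreal \<bar>stochastic_convolution N G \<sigma> u t x \<omega>\<bar> \<partial>P) \<le>
    (\<integral>\<^sup>+(s, y, h). indicator {0<..t} s * ennreal \<bar>G (t - s) (y - x)\<bar> *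
      (\<integral>\<^sup>+\<omega>. ennreal \<bar>\<sigma> (u s y \<omega>) h\<bar> \<partial>P) \<partial>intensity \<mu>)"
proof -
  interpret prob_space P using prm by (rule prm_prob_space)
  interpret \<Lambda>: sigma_finite_measure "intensity \<mu>" by (rule sigma_finite_intensity[OF levy])
  interpret pair_sigma_finite P "intensity \<mu>" ..
  define F where "F = noise_filtration P \<mu> N"
  have sF: "space (F t) = space P" for t by (simp add: F_def)
  define Q where "Q = predictable_sigma (space P) F \<Otimes>\<^sub>M
    (borel \<Otimes>\<^sub>M borel :: ((real ^ 'd) \<times> (real ^ 'd)) measure)"
  define f where "f w = (case w of ((\<omega>, s), (y, h)) \<Rightarrow>
    indicator {0<..t} s * ennreal \<bar>G (t - s) (y - x)\<bar> * ennreal \<bar>\<sigma> (u s y \<omega>) h\<bar>)" for w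
  note to_predictable = measurable_to_predictable_sigma[OF sF
    noise_filtration_subalgebra[OF prm, folded F_def] refl]
  have fm: "f \<in> borel_measurable Q"
  proof -
    note [measurable] = measurable_predictable_time[OF sF] G \<sigma>
      u[unfolded predictable_field_def, folded F_def]
    \<comment> \<open>Each factor is written as a jointly measurable function composed with
      projections, so that measurability follows factor by factor.\<close>
    have "(\<lambda>w. indicator {0<..t} (snd (fst w)) *
        ennreal \<bar>(\<lambda>(t, x). G t x) (t - snd (fst w), fst (snd w) - x)\<bar> *
        ennreal \<bar>(\<lambda>(x, h). \<sigma> x h) ((\<lambda>((\<omega>, t), x). u t x \<omega>) (fst w, fst (snd w)), snd (snd w))\<bar>)
        \<in> borel_measurable Q"
      unfolding Q_def by measurable
    then show ?thesis by (simp add: f_def[abs_def] case_prod_unfold)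
  qed
  \<comment> \<open>Exchanging the integrals requires measurability for the product with
    \<open>P\<close>; it is inherited from the coarser predictable sigma-algebra.\<close>
  have fm': "(\<lambda>(\<omega>, z). f ((\<omega>, fst z), snd z)) \<in> borel_measurable (P \<Otimes>\<^sub>M intensity \<mu>)"
  proof -
    have "(\<lambda>w. ((fst w, fst (snd w)), snd (snd w))) \<in>
        measurable (P \<Otimes>\<^sub>M (restrict_space borel {0..} \<Otimes>\<^sub>M (borel \<Otimes>\<^sub>M borel))) Q"
      unfolding Q_def
      by (intro measurable_Pair measurable_compose[OF _ to_predictable]) measurable
    from measurable_compose[OF this fm]
    have "(\<lambda>w. f ((fst w, fst (snd w)), snd (snd w))) \<in> borel_measurable
        (P \<Otimes>\<^sub>M (restrict_space borel {0..} \<Otimes>\<^sub>M (borel \<Otimes>\<^sub>M borel)))" .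
    moreover have "sets (P \<Otimes>\<^sub>M intensity \<mu>) =
        sets (P \<Otimes>\<^sub>M (restrict_space borel {0..} \<Otimes>\<^sub>M (borel \<Otimes>\<^sub>M borel)))"
      by (intro sets_pair_measure_cong refl sets_intensity[OF levy])
    ultimately show ?thesis
      by (simp add: case_prod_beta cong: measurable_cong_sets)
  qed
  have "(\<integral>\<^sup>+\<omega>. ennreal \<bar>stochastic_convolution N G \<sigma> u t x \<omega>\<bar> \<partial>P) \<le>
      (\<integral>\<^sup>+\<omega>. (\<integral>\<^sup>+z. f ((\<omega>, fst z), snd z) \<partial>N \<omega>) \<partial>P)"
  proof (intro nn_integral_mono)
    fix \<omega>
    have "ennreal \<bar>stochastic_convolution N G \<sigma> u t x \<omega>\<bar> \<le>
        (\<integral>\<^sup>+z. ennreal \<bar>indicator ({0<..t} \<times> UNIV) z *\<^sub>R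
          (case z of (s, y, h) \<Rightarrow> G (t - s) (y - x) * \<sigma> (u s y \<omega>) h)\<bar> \<partial>N \<omega>)"
      unfolding stochastic_convolution_def set_lebesgue_integral_def
      by (rule ennreal_abs_integral_le)
    also have "\<dots> = (\<integral>\<^sup>+z. f ((\<omega>, fst z), snd z) \<partial>N \<omega>)"
      by (intro nn_integral_cong) (auto simp: f_def abs_mult ennreal_mult split: split_indicator)
    finally show "ennreal \<bar>stochastic_convolution N G \<sigma> u t x \<omega>\<bar> \<le>
        (\<integral>\<^sup>+z. f ((\<omega>, fst z), snd z) \<partial>N \<omega>)" .
  qed
  also have "\<dots> = (\<integral>\<^sup>+\<omega>. (\<integral>\<^sup>+z. f ((\<omega>, fst z), snd z) \<partial>intensity \<mu>) \<partial>P)"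
    using fm unfolding Q_def F_def by (rule predictable_campbell[OF levy prm])
  also have "\<dots> = (\<integral>\<^sup>+z. (\<integral>\<^sup>+\<omega>. f ((\<omega>, fst z), snd z) \<partial>P) \<partial>intensity \<mu>)"
    using Fubini'[of "\<lambda>\<omega> z. f ((\<omega>, fst z), snd z)"] fm' by simp
  also have "\<dots> = (\<integral>\<^sup>+(s, y, h). indicator {0<..t} s * ennreal \<bar>G (t - s) (y - x)\<bar> *
      (\<integral>\<^sup>+\<omega>. ennreal \<bar>\<sigma> (u s y \<omega>) h\<bar> \<partial>P) \<partial>intensity \<mu>)"
  proof (intro nn_integral_cong)
    fix z assume z: "z \<in> space (intensity \<mu>)"
    obtain s y h where [simp]: "z = (s, y, h)" by (cases z)
    have "s \<ge> 0" using z by (simp add: space_intensity[OF levy])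
    show "(\<integral>\<^sup>+\<omega>. f ((\<omega>, fst z), snd z) \<partial>P) = (case z of (s, y, h) \<Rightarrow>
        indicator {0<..t} s * ennreal \<bar>G (t - s) (y - x)\<bar> *
        (\<integral>\<^sup>+\<omega>. ennreal \<bar>\<sigma> (u s y \<omega>) h\<bar> \<partial>P))"
    proof -
      \<comment> \<open>A section of the predictable field at fixed time and place;
        \<open>s \<ge> 0\<close> keeps it inside the space of the predictable sigma-algebra.\<close>
      have "(\<lambda>\<omega>. (\<lambda>((\<omega>, t), x). u t x \<omega>) ((\<omega>, s), y)) \<in> borel_measurable P"
      proof (rule measurable_compose[OF _ u[unfolded predictable_field_def, folded F_def]],
          rule measurable_Pair)
        show "(\<lambda>\<omega>. (\<omega>, s)) \<in> measurable P (predictable_sigma (space P) F)"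
          using measurable_compose[OF measurable_Pair2'[of s "restrict_space borel {0..}" P] to_predictable]
            \<open>s \<ge> 0\<close> by (simp add: space_restrict_space)
      qed simp
      then have [measurable]: "u s y \<in> borel_measurable P" by simp
      note [measurable] = \<sigma>
      have "(\<lambda>\<omega>. ennreal \<bar>(\<lambda>(x, h). \<sigma> x h) (u s y \<omega>, h)\<bar>) \<in> borel_measurable P"
        by measurable
      then show ?thesis
        by (simp add: f_def nn_integral_cmult)
    qed
  qed
  finally show ?thesis .
qed

theorem proposition4p2:
  fixes \<alpha> \<beta> \<nu> \<gamma> Lip K :: real
    and P :: "'w measure"
    and \<mu> :: "(real ^ 'd) measure"
    and N :: "'w \<Rightarrow> (real \<times> (real ^ 'd) \<times> (real ^ 'd)) measure"
    and \<sigma> :: "real \<Rightarrow> real ^ 'd \<Rightarrow> real"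
    and J u0 :: "real ^ 'd \<Rightarrow> real"
    and p G :: "real \<Rightarrow> real ^ 'd \<Rightarrow> real"
    and g :: "real \<Rightarrow> real"
    and u :: "real \<Rightarrow> real ^ 'd \<Rightarrow> 'w \<Rightarrow> real"
  assumes "0 < \<alpha>" "\<alpha> \<le> 2" "0 < \<beta>" "\<beta> < 1" "0 < \<nu>"
    and "levy_measure \<mu>"
    and "poisson_random_measure P (intensity \<mu>) N"
    and "isotropic_stable_density \<nu> \<alpha> p"
    and "stable_subordinator_density \<beta> g"
    and "G = green_kernel \<beta> g p"
    and "(\<lambda>(x, h). \<sigma> x h) \<in> borel_measurable (borel \<Otimes>\<^sub>M borel)"
    and "\<And>h. 0 \<le> J h"
    and "0 < Lip" "0 < K"
    and "\<And>h. \<sigma> 0 h = 0"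
    and "\<And>x y h. \<bar>\<sigma> x h - \<sigma> y h\<bar> \<le> J h * Lip * \<bar>x - y\<bar>"
    and "integrable \<mu> J" "(\<integral>h. J h \<partial>\<mu>) \<le> K"
    and "0 < \<gamma>"
    and "u0 \<in> borel_measurable borel" "bounded (range u0)"
    and "predictable_field P \<mu> N u"
    and "random_field_solution P N G \<sigma> u0 u"
    and "norm_1 P \<gamma> u < \<infinity>"
  shows "norm_1 P \<gamma> (stochastic_convolution N G \<sigma> u) \<le> ennreal (K * Lip / \<gamma>) * norm_1 P \<gamma> u"
proof -
  note levy = \<open>levy_measure \<mu>\<close> and prm = \<open>poisson_random_measure P (intensity \<mu>) N\<close>
    and p = \<open>isotropic_stable_density \<nu> \<alpha> p\<close> and g = \<open>stable_subordinator_density \<beta> g\<close>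
    and \<beta> = \<open>0 < \<beta>\<close> and \<gamma> = \<open>0 < \<gamma>\<close>
  define M where "M = norm_1 P \<gamma> u"
  have Gm: "(\<lambda>(t, x). G t x) \<in> borel_measurable (borel \<Otimes>\<^sub>M borel)"
    unfolding \<open>G = _\<close> by (rule measurable_green_kernel[OF p g])
  have mass: "(\<integral>\<^sup>+x. ennreal \<bar>G t x\<bar> \<partial>lborel) \<le> 1" if "0 < t" for t
    unfolding \<open>G = _\<close> by (rule green_kernel_mass[OF p g \<beta> that])
  \<comment> \<open>Comparison with the point 0, where \<sigma> vanishes, turns the Lipschitz bound
    into linear growth.\<close>
  have \<sigma>_le: "\<bar>\<sigma> v h\<bar> \<le> Lip * J h * \<bar>v\<bar>" for v h
    using assms(16)[of v h 0] by (simp add: assms(15) mult.commute)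
  have main: "(\<integral>\<^sup>+\<omega>. ennreal \<bar>stochastic_convolution N G \<sigma> u t x \<omega>\<bar> \<partial>P) \<le>
      ennreal (exp (\<gamma> * t)) * (ennreal (K * Lip / \<gamma>) * M)" if t: "0 < t" for t x
  proof -
    let ?k = "\<lambda>(s, y, h). indicator {0<..t} s * ennreal (exp (\<gamma> * s)) *
      ennreal \<bar>G (t - s) (y - x)\<bar> * ennreal (J h)"
    have "(\<integral>\<^sup>+\<omega>. ennreal \<bar>stochastic_convolution N G \<sigma> u t x \<omega>\<bar> \<partial>P) \<le>
        (\<integral>\<^sup>+(s, y, h). indicator {0<..t} s * ennreal \<bar>G (t - s) (y - x)\<bar> *
          (\<integral>\<^sup>+\<omega>. ennreal \<bar>\<sigma> (u s y \<omega>) h\<bar> \<partial>P) \<partial>intensity \<mu>)"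
      by (rule stochastic_convolution_expectation_le[OF levy prm Gm assms(11) assms(22)])
    \<comment> \<open>At each point the expectation of the modulus of \<open>u\<close> is at most
      \<open>exp (\<gamma> * s) * M\<close>. The exponential joins \<open>?k\<close>, while
      \<open>Lip\<close> and \<open>M\<close> are constant in the point.\<close>
    also have "\<dots> \<le> (\<integral>\<^sup>+z. (ennreal Lip * M) * ?k z \<partial>intensity \<mu>)"
    proof (intro nn_integral_mono)
      fix z :: "real \<times> (real ^ 'd) \<times> (real ^ 'd)"
      obtain s y h where z: "z = (s, y, h)" by (cases z)
      show "(case z of (s, y, h) \<Rightarrow> indicator {0<..t} s * ennreal \<bar>G (t - s) (y - x)\<bar> *
          (\<integral>\<^sup>+\<omega>. ennreal \<bar>\<sigma> (u s y \<omega>) h\<bar> \<partial>P)) \<le> (ennreal Lip * M) * ?k z"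
      proof (cases "s \<in> {0<..t}")
        case True
        have "u s y \<in> borel_measurable P"
          using True assms(23) unfolding random_field_solution_def by auto
        then have [measurable]: "(\<lambda>\<omega>. ennreal \<bar>u s y \<omega>\<bar>) \<in> borel_measurable P"
          by measurable
        have "(\<integral>\<^sup>+\<omega>. ennreal \<bar>\<sigma> (u s y \<omega>) h\<bar> \<partial>P) \<le>
            (\<integral>\<^sup>+\<omega>. ennreal (Lip * J h) * ennreal \<bar>u s y \<omega>\<bar> \<partial>P)"
          using \<sigma>_le assms(12,13)
          by (intro nn_integral_mono) (simp add: ennreal_leI flip: ennreal_mult)
        also have "\<dots> = ennreal (Lip * J h) * (\<integral>\<^sup>+\<omega>. ennreal \<bar>u s y \<omega>\<bar> \<partial>P)"
          by (rule nn_integral_cmult) measurable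
        also have "\<dots> \<le> ennreal (Lip * J h) * (ennreal (exp (\<gamma> * s)) * M)"
          unfolding M_def using True by (intro mult_left_mono norm_1_bound) auto
        finally have "ennreal \<bar>G (t - s) (y - x)\<bar> * (\<integral>\<^sup>+\<omega>. ennreal \<bar>\<sigma> (u s y \<omega>) h\<bar> \<partial>P) \<le>
            ennreal \<bar>G (t - s) (y - x)\<bar> * (ennreal (Lip * J h) * (ennreal (exp (\<gamma> * s)) * M))"
          by (rule mult_left_mono) simp
        also have "ennreal (Lip * J h) = ennreal Lip * ennreal (J h)"
          using assms(12,13) by (simp add: ennreal_mult)
        finally show ?thesis
          using True by (simp add: z ac_simps)
      qed (simp add: z)
    qed
    also have "\<dots> = (ennreal Lip * M) * (\<integral>\<^sup>+z. ?k z \<partial>intensity \<mu>)"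
    proof (rule nn_integral_cmult)
      note [measurable] = Gm
      have [measurable]: "(\<lambda>s. s) \<in> measurable (restrict_space lborel {0::real..}) borel"
        by (auto intro: measurable_restrict_space1)
      have [measurable]: "J \<in> borel_measurable \<mu>"
        using assms(17) by (rule borel_measurable_integrable)
      show "?k \<in> borel_measurable (intensity \<mu>)"
        unfolding intensity_def by measurable
    qed
    also have "\<dots> \<le> (ennreal Lip * M) * (ennreal (exp (\<gamma> * t) / \<gamma>) * ennreal K)"
      by (intro mult_left_mono intensity_integral_bound[OF levy Gm mass assms(17,12,18) \<gamma> t]) auto
    also have "\<dots> = ennreal (exp (\<gamma> * t)) * (ennreal (K * Lip / \<gamma>) * M)"
    proof -
      have "ennreal Lip * (ennreal (exp (\<gamma> * t) / \<gamma>) * ennreal K) =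
          ennreal (exp (\<gamma> * t)) * ennreal (K * Lip / \<gamma>)"
        using assms(13,14) \<gamma> by (simp add: ac_simps flip: ennreal_mult)
      then show ?thesis by (metis mult.assoc mult.commute)
    qed
    finally show ?thesis .
  qed
  show ?thesis
    unfolding norm_1_def[of P \<gamma> "stochastic_convolution N G \<sigma> u"] M_def[symmetric]
  proof (intro SUP_least)
    fix t :: real and x :: "real ^ 'd" assume "t \<in> {0<..}"
    \<comment> \<open>The weight of the norm cancels the growth in \<open>main\<close>, leaving a
      bound free of \<open>t\<close> and \<open>x\<close>.\<close>
    then have "ennreal (exp (- \<gamma> * t)) * (\<integral>\<^sup>+\<omega>. ennreal \<bar>stochastic_convolution N G \<sigma> u t x \<omega>\<bar> \<partial>P) \<le>
        ennreal (exp (- \<gamma> * t)) * (ennreal (exp (\<gamma> * t)) * (ennreal (K * Lip / \<gamma>) * M))"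
      by (intro mult_left_mono main) auto
    also have "\<dots> = (ennreal (exp (- \<gamma> * t)) * ennreal (exp (\<gamma> * t))) * (ennreal (K * Lip / \<gamma>) * M)"
      by (simp add: mult.assoc)
    also have "ennreal (exp (- \<gamma> * t)) * ennreal (exp (\<gamma> * t)) = 1"
      by (simp add: exp_minus flip: ennreal_mult)
    finally show "ennreal (exp (- \<gamma> * t)) * (\<integral>\<^sup>+\<omega>. ennreal \<bar>stochastic_convolution N G \<sigma> u t x \<omega>\<bar> \<partial>P) \<le>
        ennreal (K * Lip / \<gamma>) * M"
      by simp
  qed
qed

end
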